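(* Let $m\geq 3$ and let $\Delta_m=\{(i,j,k)\in\mathbb{Z}^3: i+j+k=m,\ i,j,k\geq 0\}$. Let $\{f^{\Delta}_v(t)\}$ be the cube recurrence in the triangle $\Delta_m$ (defined in the context). Then every value $f^{\Delta}_v(t)$ is a Laurent polynomial in the variables $x_v$ ($v$ a non-boundary vertex of $\Delta_m$). Moreover, if $\sigma:\Delta_m\to\Delta_m$ is the rotation $\sigma(i,j,k)=(j,k,i)$, then for every $v\in\Delta_m$ and every integer $t\equiv \epsilon_v \pmod 3$ we have \[ f^{\Delta}_v(t+2m)=f^{\Delta}_{\sigma v}(t). \] Consequently $f^{\Delta}_v(t+6m)=f^{\Delta}_v(t)$ for all such $v,t$.
   Context: Let $e_{12}=(1,-1,0)$, $e_{23}=(0,1,-1)$, $e_{31}=(-1,0,1)$. For a lattice point $v=(i,j,k)\in\mathbb{Z}^3$ its color is $\epsilon_v\in\{0,1,2\}$ with $\epsilon_v\equiv j-k\pmod 3$. A vertex $v=(i,j,k)\in\Delta_m$ is a boundary vertex if one of $i,j,k$ is zero; for each non-boundary vertex $v$ introduce an indeterminate $x_v$. The cube recurrence in the triangle $\Delta_m$ is the family of rational functions $f^{\Delta}_v(t)$ in these indeterminates, defined for $v\in\Delta_m$ and integers $t\equiv\epsilon_v\pmod 3$, determined by: $f^{\Delta}_v(t)=1$ for all boundary $v$ and all such $t$; $f^{\Delta}_v(\epsilon_v)=x_v$ for non-boundary $v$; and for every non-boundary $v$ and every $t\equiv\epsilon_v\pmod 3$, \[ f_v(t+3)f_v(t)=f_{v+e_{12}}(t+2)f_{v-e_{12}}(t+1)+f_{v+e_{23}}(t+2)f_{v-e_{23}}(t+1)+f_{v+e_{31}}(t+2)f_{v-e_{31}}(t+1)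 \] (with $f=f^{\Delta}$). This determines $f^{\Delta}_v(t)$ uniquely for all integers $t\equiv\epsilon_v\pmod 3$.
   Formalization: The rotation identity is proved as f_{σv}(t+2m)=f_v(t), i.e. with σ replaced by its inverse; as printed it is undefined unless 3 divides m, and it fails for m=6, v=(4,1,1), t=0, where f_v(12)=x_{(1,4,1)}, not x_{(1,1,4)}. *)

theory Defs
  imports
    "HOL-Number_Theory.Cong"
    "HOL-Computational_Algebra.Fraction_Field"
    "HOL-Library.Poly_Mapping"
    "HOL-Library.Product_Plus"
    "HOL-Library.Product_Lexorder"
begin

type_synonym vertex = "int \<times> int \<times> int"

(* The fraction field of the polynomial ring over the integers, hence the field of rational
   functions over the rationals.  There is an indeterminate for every point of the lattice;
   only those at non-boundary vertices are used below. *)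
type_synonym ratfun = "((vertex \<Rightarrow>\<^sub>0 nat) \<Rightarrow>\<^sub>0 int) fract"

definition indet :: "vertex \<Rightarrow> ratfun" where
  "indet v = Fract (Poly_Mapping.single (Poly_Mapping.single v 1) 1) 1"

(* The exponents a are finitely supported and may be negative; c holds the integer coefficients. *)
definition laurent_polynomial_in :: "vertex set \<Rightarrow> ratfun \<Rightarrow> bool" where
  "laurent_polynomial_in S g \<longleftrightarrow>
     (\<exists>c :: (vertex \<Rightarrow>\<^sub>0 int) \<Rightarrow>\<^sub>0 int.
        (\<forall>a \<in> Poly_Mapping.keys c. Poly_Mapping.keys a \<subseteq> S) \<and>
        g = (\<Sum>a \<in> Poly_Mapping.keys c.
               of_int (Poly_Mapping.lookup c a) *
               (\<Prod>v \<in> Poly_Mapping.keys a. indet v powi Poly_Mapping.lookup a v)))"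

definition e12 :: vertex where "e12 = (1, -1, 0)"
definition e23 :: vertex where "e23 = (0, 1, -1)"
definition e31 :: vertex where "e31 = (-1, 0, 1)"

fun color :: "vertex \<Rightarrow> int" where
  "color (i, j, k) = (j - k) mod 3"

definition triangle :: "int \<Rightarrow> vertex set" where
  "triangle m = {(i, j, k). i + j + k = m \<and> i \<ge> 0 \<and> j \<ge> 0 \<and> k \<ge> 0}"

definition triangle_boundary :: "int \<Rightarrow> vertex set" where
  "triangle_boundary m = {(i, j, k) \<in> triangle m. i = 0 \<or> j = 0 \<or> k = 0}"

definition triangle_interior :: "int \<Rightarrow> vertex set" where
  "triangle_interior m = triangle m - triangle_boundary m"

fun rotation :: "vertex \<Rightarrow> vertex" where
  "rotation (i, j, k) = (j, k, i)"

(* Orientation pitfall.  On the triangle of size m, color (rotation v) is congruent to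
   color v + 2 * m modulo 3, so f (rotation v) (t + 2 * m) belongs to the family
   whenever f v t does.  With this rotation the periodicity is f (rotation v) (t + 2 * m) = f v t.
   The identity f v (t + 2 * m) = f (rotation v) t is ill-posed unless 3 divides m, and fails for
   m = 6; it becomes the one above when the rotation is taken as (i, j, k) to (k, i, j). *)
lemma color_rotation:
  assumes "v \<in> triangle m"
  shows "[color (rotation v) = color v + 2 * m] (mod 3)"
proof -
  obtain i j k where v: "v = (i, j, k)" by (cases v)
  then have "m = i + j + k" using assms by (simp add: triangle_def)
  then have "(k - i) - (j - k + 2 * m) = 3 * (- i - j)" by simp
  then have "[k - i = j - k + 2 * m] (mod 3)" by (simp only: cong_iff_dvd_diff dvd_triv_left)
  then show ?thesis by (simp add: v cong_def mod_add_left_eq)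
qed

(* Values f v t with v outside the triangle, or with t not congruent to color v modulo 3,
   are not part of the family and are left unconstrained. *)
definition cube_recurrence :: "int \<Rightarrow> (vertex \<Rightarrow> int \<Rightarrow> ratfun) \<Rightarrow> bool" where
  "cube_recurrence m f \<longleftrightarrow>
     (\<forall>v \<in> triangle_boundary m. \<forall>t. [t = color v] (mod 3) \<longrightarrow> f v t = 1) \<and>
     (\<forall>v \<in> triangle_interior m. f v (color v) = indet v) \<and>
     (\<forall>v \<in> triangle_interior m. \<forall>t. [t = color v] (mod 3) \<longrightarrow>
        f v (t + 3) * f v t =
          f (v + e12) (t + 2) * f (v - e12) (t + 1) +
          f (v + e23) (t + 2) * f (v - e23) (t + 1) +
          f (v + e31) (t + 2) * f (v - e31) (t + 1))"


subsection \<open>Existence of the cube recurrence\<close>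

(* Quotients of nonzero polynomials with nonnegative coefficients are nonzero and closed under the
   operations of the recurrence, so no division by zero occurs. *)

definition coeffs_nonneg :: "((vertex \<Rightarrow>\<^sub>0 nat) \<Rightarrow>\<^sub>0 int) \<Rightarrow> bool" where
  "coeffs_nonneg p \<longleftrightarrow> p \<noteq> 0 \<and> (\<forall>k. Poly_Mapping.lookup p k \<ge> 0)"

definition subtraction_free :: "ratfun \<Rightarrow> bool" where
  "subtraction_free g \<longleftrightarrow> (\<exists>p q. coeffs_nonneg p \<and> coeffs_nonneg q \<and> g = Fract p q)"

lemma coeffs_nonneg_mult:
  assumes "coeffs_nonneg p" "coeffs_nonneg q"
  shows "coeffs_nonneg (p * q)"
proof -
  have "Poly_Mapping.lookup (p * q) k \<ge> 0" for k
    using assms unfolding coeffs_nonneg_def times_poly_mapping.rep_eq prod_fun_def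
    by (auto simp: Sum_any.expand_set when_def intro!: sum_nonneg mult_nonneg_nonneg)
  then show ?thesis using assms by (auto simp: coeffs_nonneg_def)
qed

lemma coeffs_nonneg_add:
  assumes "coeffs_nonneg p" "coeffs_nonneg q"
  shows "coeffs_nonneg (p + q)"
proof -
  have "\<exists>k. Poly_Mapping.lookup p k \<noteq> Poly_Mapping.lookup 0 k"
    using assms(1) poly_mapping_eqI[of p 0] unfolding coeffs_nonneg_def by blast
  then obtain k where "Poly_Mapping.lookup p k \<noteq> 0" by auto
  moreover have "Poly_Mapping.lookup p k \<ge> 0" "Poly_Mapping.lookup q k \<ge> 0"
    using assms by (simp_all add: coeffs_nonneg_def)
  ultimately have "Poly_Mapping.lookup (p + q) k \<noteq> Poly_Mapping.lookup 0 k"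
    by (simp add: lookup_add)
  then have "p + q \<noteq> 0" by metis
  then show ?thesis using assms by (simp add: coeffs_nonneg_def lookup_add)
qed

lemma subtraction_freeI:
  "coeffs_nonneg p \<Longrightarrow> coeffs_nonneg q \<Longrightarrow> g = Fract p q \<Longrightarrow> subtraction_free g"
  unfolding subtraction_free_def by blast

lemma subtraction_freeE:
  assumes "subtraction_free g"
  obtains p q where "coeffs_nonneg p" "coeffs_nonneg q" "p \<noteq> 0" "q \<noteq> 0" "g = Fract p q"
  using assms unfolding subtraction_free_def coeffs_nonneg_def by blast

lemma subtraction_free_nonzero: "subtraction_free g \<Longrightarrow> g \<noteq> 0"
proof (erule subtraction_freeE)
  fix p q assume "p \<noteq> 0" "q \<noteq> 0" "g = Fract p q"
  then show "g \<noteq> 0"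
    using eq_fract(1)[of q 1 p 0] by (simp add: fract_collapse)
qed

lemma subtraction_free_mult:
  assumes "subtraction_free g" "subtraction_free h"
  shows "subtraction_free (g * h)"
proof -
  obtain p q where pq: "coeffs_nonneg p" "coeffs_nonneg q" "g = Fract p q"
    using assms(1) by (rule subtraction_freeE)
  obtain r s where rs: "coeffs_nonneg r" "coeffs_nonneg s" "h = Fract r s"
    using assms(2) by (rule subtraction_freeE)
  have "g * h = Fract (p * r) (q * s)" using pq(3) rs(3) by simp
  with pq rs show ?thesis by (intro subtraction_freeI[OF coeffs_nonneg_mult coeffs_nonneg_mult])
qed

lemma subtraction_free_divide:
  assumes "subtraction_free g" "subtraction_free h"
  shows "subtraction_free (g / h)"
proof -
  obtain p q where pq: "coeffs_nonneg p" "coeffs_nonneg q" "g = Fract p q"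
    using assms(1) by (rule subtraction_freeE)
  obtain r s where rs: "coeffs_nonneg r" "coeffs_nonneg s" "h = Fract r s"
    using assms(2) by (rule subtraction_freeE)
  have "g / h = Fract (p * s) (q * r)" using pq(3) rs(3) by simp
  with pq rs show ?thesis by (intro subtraction_freeI[OF coeffs_nonneg_mult coeffs_nonneg_mult])
qed

lemma subtraction_free_add:
  assumes "subtraction_free g" "subtraction_free h"
  shows "subtraction_free (g + h)"
proof -
  obtain p q where pq: "coeffs_nonneg p" "coeffs_nonneg q" "q \<noteq> 0" "g = Fract p q"
    using assms(1) by (rule subtraction_freeE)
  obtain r s where rs: "coeffs_nonneg r" "coeffs_nonneg s" "s \<noteq> 0" "h = Fract r s"
    using assms(2) by (rule subtraction_freeE)
  have "g + h = Fract (p * s + r * q) (q * s)" using pq(3,4) rs(3,4) by simp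
  moreover have "coeffs_nonneg (p * s + r * q)" "coeffs_nonneg (q * s)"
    using pq rs by (simp_all add: coeffs_nonneg_add coeffs_nonneg_mult)
  ultimately show ?thesis by (intro subtraction_freeI)
qed

lemma coeffs_nonneg_single:
  assumes "c > 0"
  shows "coeffs_nonneg (Poly_Mapping.single a c)"
proof -
  have "Poly_Mapping.lookup (Poly_Mapping.single a c) a \<noteq> Poly_Mapping.lookup 0 a"
    using assms by simp
  then have "Poly_Mapping.single a c \<noteq> 0" by metis
  then show ?thesis using assms by (simp add: coeffs_nonneg_def lookup_single when_def)
qed

lemma coeffs_nonneg_one: "coeffs_nonneg 1"
  using coeffs_nonneg_single[of 1 0] by simp

lemma subtraction_free_one: "subtraction_free 1"
  by (rule subtraction_freeI[OF coeffs_nonneg_one coeffs_nonneg_one One_fract_def])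

lemma subtraction_free_indet: "subtraction_free (indet v)"
  by (rule subtraction_freeI[OF coeffs_nonneg_single[OF zero_less_one] coeffs_nonneg_one indet_def])

(* Both time directions at once: e and its negative are exchanged when time is reversed. *)
function cube_iter :: "int \<Rightarrow> vertex \<Rightarrow> vertex \<Rightarrow> vertex \<Rightarrow> nat \<Rightarrow> vertex \<Rightarrow> ratfun" where
  "cube_iter m a b c n v =
     (if v \<notin> triangle_interior m then 1
      else if n < 3 then indet v
      else (cube_iter m a b c (n - 1) (v + a) * cube_iter m a b c (n - 2) (v - a) +
            cube_iter m a b c (n - 1) (v + b) * cube_iter m a b c (n - 2) (v - b) +
            cube_iter m a b c (n - 1) (v + c) * cube_iter m a b c (n - 2) (v - c)) /
           cube_iter m a b c (n - 3) v)"
  by pat_completeness simp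
termination by (relation "measure (\<lambda>(m, a, b, c, n, v). n)") simp_all

declare cube_iter.simps [simp del]

lemma subtraction_free_cube_iter: "subtraction_free (cube_iter m a b c n v)"
proof (induction n arbitrary: v rule: less_induct)
  case (less n)
  show ?case
    by (subst cube_iter.simps)
      (auto intro!: subtraction_free_add subtraction_free_mult subtraction_free_divide
          subtraction_free_one subtraction_free_indet less.IH)
qed

lemma cube_iter_rec:
  assumes "v \<in> triangle_interior m"
  shows "cube_iter m a b c (n + 3) v * cube_iter m a b c n v =
           cube_iter m a b c (n + 2) (v + a) * cube_iter m a b c (n + 1) (v - a) +
           cube_iter m a b c (n + 2) (v + b) * cube_iter m a b c (n + 1) (v - b) +
           cube_iter m a b c (n + 2) (v + c) * cube_iter m a b c (n + 1) (v - c)"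
proof -
  have "n + 3 - 1 = n + 2" "n + 3 - 2 = n + 1" "n + 3 - 3 = n" "\<not> n + 3 < 3" by auto
  then show ?thesis
    using assms subtraction_free_nonzero[OF subtraction_free_cube_iter[of m a b c n v]]
    by (subst cube_iter.simps) (simp del: add_diff_cancel_right')
qed

lemma cube_recurrence_exists: "\<exists>f. cube_recurrence m f"
proof -
  define F where "F = cube_iter m e12 e23 e31"
  define B where "B = cube_iter m (- e12) (- e23) (- e31)"
  define f where "f = (\<lambda>v t. if t \<ge> 0 then F (nat t) v else B (nat (2 - t)) v)"
  have FB: "F n v = (if v \<in> triangle_interior m then indet v else 1)"
           "B n v = (if v \<in> triangle_interior m then indet v else 1)" if "n < 3" for n v
    using that unfolding F_def B_def by (simp_all add: cube_iter.simps)
  have fB: "f v t = B (nat (2 - t)) v" if "t \<le> 2" for v t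
    using that by (auto simp: f_def FB)
  have rec: "f v (t + 3) * f v t =
          f (v + e12) (t + 2) * f (v - e12) (t + 1) +
          f (v + e23) (t + 2) * f (v - e23) (t + 1) +
          f (v + e31) (t + 2) * f (v - e31) (t + 1)" if v: "v \<in> triangle_interior m" for v t
  proof (cases "t \<ge> 0")
    case True
    then have "nat (t + 3) = nat t + 3" "nat (t + 2) = nat t + 2" "nat (t + 1) = nat t + 1"
      by auto
    then show ?thesis
      using True cube_iter_rec[OF v, of e12 e23 e31 "nat t"] by (simp add: f_def F_def)
  next
    case False
    define n where "n = nat (- 1 - t)"
    have n: "nat (2 - t) = n + 3" "nat (2 - (t + 1)) = n + 2" "nat (2 - (t + 2)) = n + 1"
        "nat (2 - (t + 3)) = n"
      using False by (auto simp: n_def)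
    have "f u t = B (n + 3) u" "f u (t + 1) = B (n + 2) u" "f u (t + 2) = B (n + 1) u"
        "f u (t + 3) = B n u" for u
      using False fB[of t u] fB[of "t + 1" u] fB[of "t + 2" u] fB[of "t + 3" u] unfolding n
      by linarith+
    then show ?thesis
      using cube_iter_rec[OF v, of "- e12" "- e23" "- e31" n] by (simp add: B_def mult.commute)
  qed
  have "f v t = 1" if "v \<in> triangle_boundary m" for v t
    using that cube_iter.simps[of m _ _ _ _ v]
    unfolding f_def F_def B_def triangle_interior_def by simp
  moreover have "f v (color v) = indet v" if "v \<in> triangle_interior m" for v
  proof -
    obtain i j k where "v = (i, j, k)" by (cases v)
    then have "color v \<ge> 0" "color v < 3" by simp_all
    then show ?thesis using that FB(1)[of "nat (color v)" v] by (simp add: f_def)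
  qed
  ultimately show ?thesis using rec unfolding cube_recurrence_def by blast
qed

end

theory Submission
  imports Defs
begin

text \<open>
  Let three walkers $p \le r \le s \le p + m$ move on the integers.  The point with gaps
  $i = r - p$, $k = s - r$, $j = p + m - s$ and time $t = p + r + s - 2m$ identifies the space-time
  of the triangle with this prism, and the recurrence becomes the cube relation for unit steps of
  the walkers.  Attach to a position the set of residues modulo $m$ that the three walkers have
  jointly crossed an odd number of times.  A walker that advances by $m$ crosses every residue once, so
  two such turns cancel.  Hence replacing
  $(p, r, s)$ by $(s, p + m, r + m)$ does not change this set, while it rotates the triangle and
  adds $2m$ to the time.

  The Pfaffians of the principal submatrices of a skew-symmetric matrix, bordered by one further
  index to reach the sets of odd size, satisfy the cube relation up to signs.  The entries can be
  chosen so that the Pfaffians agree, up to explicit signs, with the given values on the wall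
  $p = 0$; as the relation propagates values from there, every value is plus or minus the Pfaffian
  of the crossed set, and periodicity follows.

  For the Laurent property fix a residue $x$.  The relation for $x$ and the two walkers that move
  along a rhombus is linear in the Pfaffians of the crossed sets with $x$ toggled, and its
  coefficients are initial variables.  Sweeping the initial slice away from the places where a
  walker crosses $x$, each rhombus yields its fourth corner from the other three by dividing by one
  initial variable.  So all these Pfaffians are Laurent polynomials.  On the boundary of the slice
  they determine the matrix entries polynomially, and all values are integer polynomials in the
  entries.
\<close>

subsection \<open>Pfaffians indexed by finite sets\<close>

abbreviation symdiff :: "'a set \<Rightarrow> 'a set \<Rightarrow> 'a set" (infixl "\<triangle>" 65) where
  "A \<triangle> B \<equiv> sym_diff A B"

definition before_sign :: "'i::linorder \<Rightarrow> 'i \<Rightarrow> 'a::comm_ring_1" where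
  "before_sign b a = (if b < a then - 1 else 1)"

text \<open>For finite \<open>X\<close> this is minus one to the number of elements of
  \<open>X\<close> below \<open>a\<close>. As \<open>before_sign a a\<close> is 1, the value is the
  same whether or not \<open>a\<close> lies in \<open>X\<close>.\<close>

definition position_sign :: "'i::linorder \<Rightarrow> 'i set \<Rightarrow> 'a::comm_ring_1" where
  "position_sign a X = (\<Prod>b\<in>X. before_sign b a)"

lemma before_sign_square [simp]: "before_sign b a * before_sign b a = 1"
  by (simp add: before_sign_def)

lemma before_sign_self [simp]: "before_sign a a = 1"
  by (simp add: before_sign_def)

lemma position_sign_square [simp]: "position_sign a X * position_sign a X = 1"
  by (simp add: position_sign_def flip: prod.distrib)

lemma before_sign_cancel [simp]: "before_sign b a * (before_sign b a * c) = c"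
  by (simp flip: mult.assoc)

lemma position_sign_cancel [simp]: "position_sign a X * (position_sign a X * c) = c"
  by (simp flip: mult.assoc)

lemma position_sign_cases: "position_sign a X = (1 :: 'a::comm_ring_1) \<or> position_sign a X = (- 1 :: 'a)"
proof (induction X rule: infinite_finite_induct)
  case (insert b X)
  then show ?case by (auto simp: position_sign_def before_sign_def)
qed (simp_all add: position_sign_def)

lemma position_sign_insert:
  "finite X \<Longrightarrow> b \<notin> X \<Longrightarrow> position_sign a (insert b X) = before_sign b a * position_sign a X"
  by (simp add: position_sign_def)

lemma position_sign_remove:
  assumes "finite X" "b \<in> X"
  shows "position_sign a (X - {b}) = (before_sign b a * position_sign a X :: 'a::comm_ring_1)"
proof -
  have "position_sign a X = (before_sign b a * position_sign a (X - {b}) :: 'a)"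
    using assms by (simp add: position_sign_def prod.remove)
  then show ?thesis by (simp add: mult.assoc[symmetric])
qed

text \<open>Elements common to both sets contribute the square of a sign, so only the symmetric
  difference matters.\<close>

lemma position_sign_symdiff:
  fixes X Y :: "'i::linorder set"
  assumes "finite X" "finite Y"
  shows "position_sign a (X \<triangle> Y) = (position_sign a X * position_sign a Y :: 'a::comm_ring_1)"
proof -
  define s :: "'i set \<Rightarrow> 'a" where "s = position_sign a"
  have X: "s X = s (X - Y) * s (X \<inter> Y)"
    unfolding s_def position_sign_def using assms by (subst prod.union_disjoint[symmetric]) (auto intro!: prod.cong)
  have Y: "s Y = s (Y - X) * s (X \<inter> Y)"
    unfolding s_def position_sign_def using assms by (subst prod.union_disjoint[symmetric]) (auto intro!: prod.cong)
  have XY: "s (X \<triangle> Y) = s (X - Y) * s (Y - X)"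
    unfolding s_def position_sign_def using assms by (subst prod.union_disjoint) auto
  have "s X * s Y =
      s (X - Y) * s (Y - X) *
      (s (X \<inter> Y) * s (X \<inter> Y))"
    unfolding X Y by (simp only: mult_ac)
  then show ?thesis using XY by (simp add: mult.assoc s_def)
qed

lemma position_sign_Min:
  assumes "finite X"
  shows "position_sign (Min X) X = (1 :: 'a::comm_ring_1)"
proof -
  have "before_sign b (Min X) = (1 :: 'a)" if "b \<in> X" for b
    using Min_le[OF assms that] by (simp add: before_sign_def)
  then show ?thesis by (simp add: position_sign_def)
qed

section \<open>Pfaffians by recursion on the smallest index, and expansion along any row\<close>

context
  notes sum.cong [fundef_cong]
begin

text \<open>A singleton gives an empty sum, so sets of odd size have Pfaffian 0; infinite sets get 0
  as a default. The congruence rule for sums tells the termination proof that \<open>b\<close> lies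
  in \<open>X - {Min X}\<close>.\<close>

function pfaffian :: "('i::linorder \<Rightarrow> 'i \<Rightarrow> 'a::comm_ring_1) \<Rightarrow> 'i set \<Rightarrow> 'a" where
  "pfaffian A X =
     (if infinite X then 0 else if X = {} then 1
      else \<Sum>b\<in>X - {Min X}. position_sign b (X - {Min X}) * A (Min X) b * pfaffian A (X - {Min X} - {b}))"
  by pat_completeness simp
termination
proof (relation "measure (\<lambda>(A, X). card X)", goal_cases)
  case (2 A X b)
  then have "X - {Min X} - {b} \<subset> X" by auto
  then have "card (X - {Min X} - {b}) < card X" using 2 by (intro psubset_card_mono) auto
  then show ?case by simp
qed simp

end

declare pfaffian.simps [simp del]

text \<open>The index \<open>a\<close> is not tied to \<open>X\<close>. For \<open>a\<close> outside
  \<open>X\<close> this is a signed Pfaffian of \<open>insert a X\<close>; for \<open>a\<close>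
  inside it is the expansion of a Pfaffian with a repeated index. The bilinear identity uses both
  cases.\<close>

definition pfaffian_row :: "('i::linorder \<Rightarrow> 'i \<Rightarrow> 'a::comm_ring_1) \<Rightarrow> 'i \<Rightarrow> 'i set \<Rightarrow> 'a" where
  "pfaffian_row A a X = (\<Sum>b\<in>X. position_sign b X * A a b * pfaffian A (X - {b}))"

lemma pfaffian_empty [simp]: "pfaffian A {} = 1"
  by (simp add: pfaffian.simps)

lemma pfaffian_Min:
  "finite X \<Longrightarrow> X \<noteq> {} \<Longrightarrow> pfaffian A X = pfaffian_row A (Min X) (X - {Min X})"
  by (subst pfaffian.simps) (simp add: pfaffian_row_def)

lemma Diff_singleton_commute: "X - {a} - {b} = X - {b} - {a}"
  by auto

lemma sum_swap_off_diagonal: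
  assumes "finite X"
  shows "(\<Sum>a\<in>X. \<Sum>b\<in>X - {a}. f a b) = (\<Sum>b\<in>X. \<Sum>a\<in>X - {b}. f a b)"
proof -
  have "X - {a} = {b \<in> X. a \<noteq> b}" "X - {a} = {b \<in> X. b \<noteq> a}" for a by auto
  then show ?thesis using sum.swap_restrict[OF assms assms, of f "(\<noteq>)"] by simp
qed

text \<open>Expanding along the minimum and then along \<open>a\<close> produces the same double sum
  as the other order. The induction hypothesis, for the set without the minimum and a partner of it,
  gives the expansion along \<open>a\<close>; the rest compares signs.\<close>

lemma pfaffian_expand:
  fixes A :: "'i::linorder \<Rightarrow> 'i \<Rightarrow> 'a::comm_ring_1"
  assumes skew: "\<And>a b. A b a = - A a b" and "finite X" "a \<in> X"
  shows "pfaffian_row A a (X - {a}) = position_sign a X * pfaffian A X"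
  using assms(2,3)
proof (induction "card X" arbitrary: X a rule: less_induct)
  case less
  let ?m = "Min X"
  have m: "?m \<in> X" "\<And>b. b \<in> X \<Longrightarrow> ?m \<le> b"
    using less.prems by (metis Min_in empty_iff, simp)
  show ?case
  proof (cases "a = ?m")
    case True
    then show ?thesis
      using pfaffian_Min[of X A] position_sign_Min[of X, where 'a = 'a] less.prems m(1)
      by (metis empty_iff mult_1)
  next
    case False
    define Y where "Y = X - {a} - {?m}"
    have Y: "finite Y" "a \<notin> Y" "?m \<notin> Y" "X - {?m} - {a} = Y" using less.prems by (auto simp: Y_def)
    have bm: "before_sign ?m b = (- 1 :: 'a)" if "b \<in> Y \<or> b = a" for b
    proof -
      have "?m \<le> b" using that m(2) less.prems(2) by (auto simp: Y_def)
      moreover have "?m \<noteq> b" using that False by (auto simp: Y_def)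
      ultimately show ?thesis by (simp add: before_sign_def)
    qed
    \<comment> \<open>Here the outer expansion is along \<open>a\<close> and the inner one along the
      minimum, which is still present in \<open>X - {a} - {b}\<close>.\<close>
    have L: "position_sign b (X - {a}) * A a b * pfaffian A (X - {a} - {b}) =
        (\<Sum>w\<in>Y - {b}. position_sign b (X - {a}) * A a b *
           (position_sign w (Y - {b}) * A ?m w * pfaffian A (Y - {b} - {w})))" if b: "b \<in> Y" for b
    proof -
      have ne: "X - {a} - {b} \<noteq> {}" "finite (X - {a} - {b})" using b m False less.prems by (auto simp: Y_def)
      have "Min (X - {a} - {b}) = ?m"
        using b m False less.prems by (intro Min_eqI) (auto simp: Y_def)
      moreover have "X - {a} - {b} - {?m} = Y - {b}" by (auto simp: Y_def)
      ultimately have "pfaffian A (X - {a} - {b}) = pfaffian_row A ?m (Y - {b})"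
        using pfaffian_Min[OF ne(2,1), of A] by simp
      then show ?thesis by (simp add: pfaffian_row_def sum_distrib_left)
    qed
    have R: "position_sign a X * (position_sign w (X - {?m}) * A ?m w * pfaffian A (X - {?m} - {w})) =
        (\<Sum>b\<in>Y - {w}. position_sign a X * position_sign w (X - {?m}) * A ?m w * position_sign a (X - {?m} - {w}) *
           (position_sign b (Y - {w}) * A a b * pfaffian A (Y - {w} - {b})))" if w: "w \<in> Y" for w
    proof -
      have a: "a \<in> X - {?m} - {w}" using w False less.prems by (auto simp: Y_def)
      have "X - {?m} - {w} \<subset> X" using m by auto
      then have "card (X - {?m} - {w}) < card X" using less.prems by (simp add: psubset_card_mono)
      from less.hyps[OF this _ a] less.prems
      have "pfaffian_row A a (X - {?m} - {w} - {a}) = position_sign a (X - {?m} - {w}) * pfaffian A (X - {?m} - {w})"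
        by simp
      moreover have "X - {?m} - {w} - {a} = Y - {w}" by (auto simp: Y_def)
      ultimately have "pfaffian A (X - {?m} - {w}) = position_sign a (X - {?m} - {w}) * pfaffian_row A a (Y - {w})"
        by (simp add: mult.assoc[symmetric])
      then show ?thesis by (simp add: pfaffian_row_def sum_distrib_left mult_ac)
    qed
    \<comment> \<open>Once each sign is split over \<open>Z\<close> and the four special indices,
      the two sides differ only by squares of signs.\<close>
    have coef: "position_sign b (X - {a}) * position_sign w (Y - {b}) =
        (position_sign a X * position_sign w (X - {?m}) * position_sign a (X - {?m} - {w}) * position_sign b (Y - {w}) :: 'a)"
      if "b \<in> Y" "w \<in> Y" "b \<noteq> w" for b w
    proof -
      have X: "X = insert a (insert ?m (insert b (insert w (Y - {b} - {w}))))"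
        using that m less.prems by (auto simp: Y_def)
      define Z where "Z = Y - {b} - {w}"
      have Z: "finite Z" "a \<notin> Z" "?m \<notin> Z" "b \<notin> Z" "w \<notin> Z" using Y by (auto simp: Z_def)
      have ne: "a \<noteq> b" "a \<noteq> w" "?m \<noteq> b" "?m \<noteq> w" "a \<noteq> ?m" using that Y False by auto
      have sets: "X - {a} = insert ?m (insert b (insert w Z))" "Y - {b} = insert w Z"
        "X - {?m} = insert a (insert b (insert w Z))" "X - {?m} - {w} = insert a (insert b Z)" "Y - {w} = insert b Z"
        "X = insert a (insert ?m (insert b (insert w Z)))"
        using that m less.prems False by (auto simp: Y_def Z_def)
      have opp: "before_sign b w = (- before_sign w b :: 'a)" "before_sign a b = (- before_sign b a :: 'a)"
          "before_sign a w = (- before_sign w a :: 'a)"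
        using ne that by (auto simp: before_sign_def)
      have "position_sign b (X - {a}) * position_sign w (Y - {b}) =
          - (before_sign w b * position_sign b Z * position_sign w Z :: 'a)"
        unfolding sets(1,2) using Z ne that bm by (simp add: position_sign_insert mult_ac)
      moreover have "position_sign a X * position_sign w (X - {?m}) * position_sign a (X - {?m} - {w}) * position_sign b (Y - {w}) =
          - (before_sign w b * position_sign b Z * position_sign w Z :: 'a)
            * (before_sign w a * before_sign w a) * (before_sign b a * before_sign b a) * (position_sign a Z * position_sign a Z)"
        apply (subst sets(6))
        unfolding sets(4) unfolding sets(3,5) using Z ne that bm opp by (simp add: position_sign_insert mult_ac)
      ultimately show ?thesis by simp
    qed
    have "pfaffian_row A a (X - {a}) =
        position_sign ?m (X - {a}) * A a ?m * pfaffian A Y + (\<Sum>b\<in>Y. position_sign b (X - {a}) * A a b * pfaffian A (X - {a} - {b}))"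
      unfolding pfaffian_row_def using m False less.prems
      by (subst sum.remove[of _ ?m]) (auto simp: Y_def)
    also have "(\<Sum>b\<in>Y. position_sign b (X - {a}) * A a b * pfaffian A (X - {a} - {b})) =
        (\<Sum>b\<in>Y. \<Sum>w\<in>Y - {b}. position_sign b (X - {a}) * A a b *
           (position_sign w (Y - {b}) * A ?m w * pfaffian A (Y - {b} - {w})))"
      by (rule sum.cong) (use L in auto)
    also have "\<dots> = (\<Sum>w\<in>Y. \<Sum>b\<in>Y - {w}. position_sign b (X - {a}) * A a b *
           (position_sign w (Y - {b}) * A ?m w * pfaffian A (Y - {b} - {w})))"
      by (rule sum_swap_off_diagonal) (rule Y(1))
    also have "\<dots> = (\<Sum>w\<in>Y. \<Sum>b\<in>Y - {w}. position_sign a X * position_sign w (X - {?m}) * A ?m w * position_sign a (X - {?m} - {w}) *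
           (position_sign b (Y - {w}) * A a b * pfaffian A (Y - {w} - {b})))"
    proof (intro sum.cong refl, goal_cases)
      case (1 w b)
      then have "position_sign b (X - {a}) * position_sign w (Y - {b}) * (A a b * A ?m w * pfaffian A (Y - {b} - {w})) =
        position_sign a X * position_sign w (X - {?m}) * position_sign a (X - {?m} - {w}) * position_sign b (Y - {w})
          * (A a b * A ?m w * pfaffian A (Y - {w} - {b}))"
        by (subst coef) (auto simp: Diff_singleton_commute)
      then show ?case by (simp only: mult_ac)
    qed
    also have "\<dots> = (\<Sum>w\<in>Y. position_sign a X * (position_sign w (X - {?m}) * A ?m w * pfaffian A (X - {?m} - {w})))"
      by (rule sum.cong) (use R in auto)
    \<comment> \<open>The pair formed by \<open>a\<close> and the minimum is the one term outside
      the double sums; skewness supplies the sign that moving \<open>a\<close> past the minimum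
      costs.\<close>
    also have "position_sign ?m (X - {a}) * A a ?m * pfaffian A Y =
        position_sign a X * (position_sign a (X - {?m}) * A ?m a * pfaffian A (X - {?m} - {a}))"
    proof -
      have 1: "position_sign ?m (X - {a}) = (1::'a)"
      proof -
        have "Min (X - {a}) = ?m" using m False less.prems by (intro Min_eqI) auto
        then show ?thesis using position_sign_Min[of "X - {a}", where 'a = 'a] less.prems by simp
      qed
      have 2: "position_sign a X * position_sign a (X - {?m}) = (- 1 :: 'a)"
        using position_sign_remove[of X ?m a, where 'a='a] m less.prems bm[of a] by simp
      have "position_sign a X * (position_sign a (X - {?m}) * A ?m a * pfaffian A (X - {?m} - {a})) =
        (position_sign a X * position_sign a (X - {?m})) * (A ?m a * pfaffian A (X - {?m} - {a}))"
        by (simp only: mult_ac)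
      also have "\<dots> = A a ?m * pfaffian A Y" unfolding 2 Y(4) using skew[of ?m a] by simp
      finally show ?thesis using 1 by simp
    qed
    also have "position_sign a X * (position_sign a (X - {?m}) * A ?m a * pfaffian A (X - {?m} - {a})) +
        (\<Sum>w\<in>Y. position_sign a X * (position_sign w (X - {?m}) * A ?m w * pfaffian A (X - {?m} - {w}))) =
        position_sign a X * pfaffian_row A ?m (X - {?m})"
    proof -
      have "pfaffian_row A ?m (X - {?m}) = position_sign a (X - {?m}) * A ?m a * pfaffian A (X - {?m} - {a}) +
          (\<Sum>w\<in>Y. position_sign w (X - {?m}) * A ?m w * pfaffian A (X - {?m} - {w}))"
        unfolding pfaffian_row_def using less.prems False Y(4) by (subst sum.remove[of _ a]) auto
      then show ?thesis by (simp add: distrib_left sum_distrib_left)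
    qed
    also have "\<dots> = position_sign a X * pfaffian A X"
      using pfaffian_Min[of X A] less.prems by (metis empty_iff)
    finally show ?thesis .
  qed
qed

lemma pfaffian_row_insert:
  fixes A :: "'i::linorder \<Rightarrow> 'i \<Rightarrow> 'a::comm_ring_1"
  assumes "\<And>a b. A b a = - A a b" and "finite X" "a \<notin> X"
  shows "pfaffian_row A a X = position_sign a X * pfaffian A (insert a X)"
  using pfaffian_expand[OF assms(1), of "insert a X" a] assms(2,3)
  by (simp add: position_sign_insert)

text \<open>An index is repeated: expanding again along \<open>a\<close> gives a double sum whose
  summand changes sign when \<open>b\<close> and \<open>w\<close> are exchanged. The sum equals its
  own negative, and 2 is not 0.\<close>

lemma pfaffian_row_mem:
  fixes A :: "'i::linorder \<Rightarrow> 'i \<Rightarrow> 'a::idom"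
  assumes skew: "\<And>a b. A b a = - A a b" and two: "(2 :: 'a) \<noteq> 0" and X: "finite X" "a \<in> X"
  shows "pfaffian_row A a X = 0"
proof -
  define Y where "Y = X - {a}"
  have Y: "finite Y" "a \<notin> Y" "X = insert a Y" using X by (auto simp: Y_def)
  have "A a a = - A a a" by (rule skew)
  then have "2 * A a a = 0" by (metis add.right_inverse mult_2)
  then have Aaa: "A a a = 0" using two by simp
  define t where "t = (\<lambda>b w. (position_sign b X * position_sign a (X - {b}) * position_sign w (Y - {b})) *
      (A a b * A a w * pfaffian A (Y - {b} - {w})))"
  have "position_sign b X * A a b * pfaffian A (X - {b}) = (\<Sum>w\<in>Y - {b}. t b w)" if b: "b \<in> Y" for b
  proof -
    have "pfaffian_row A a (X - {b} - {a}) = position_sign a (X - {b}) * pfaffian A (X - {b})"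
      using b Y by (intro pfaffian_expand[of A, OF skew]) auto
    moreover have "X - {b} - {a} = Y - {b}" using Y by auto
    ultimately have "pfaffian A (X - {b}) = position_sign a (X - {b}) * pfaffian_row A a (Y - {b})"
      by (simp add: mult.assoc[symmetric])
    then show ?thesis by (simp add: pfaffian_row_def sum_distrib_left t_def mult_ac)
  qed
  then have row: "pfaffian_row A a X = (\<Sum>b\<in>Y. \<Sum>w\<in>Y - {b}. t b w)"
    unfolding pfaffian_row_def using Y Aaa by simp
  have anti: "t b w = - t w b" if "b \<in> Y" "w \<in> Y - {b}" for b w
  proof -
    have ne: "a \<noteq> b" "a \<noteq> w" "b \<noteq> w" using that Y by auto
    have opp: "before_sign b w = (- before_sign w b :: 'a)" "before_sign a b = (- before_sign b a :: 'a)"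
        "before_sign a w = (- before_sign w a :: 'a)"
      using ne by (auto simp: before_sign_def)
    have "position_sign b X * position_sign a (X - {b}) * position_sign w (Y - {b}) =
        - (position_sign w X * position_sign a (X - {w}) * position_sign b (Y - {w}) :: 'a)"
      using that ne Y X unfolding Y_def by (simp add: position_sign_remove opp mult_ac)
    then show ?thesis unfolding t_def by (simp add: Diff_singleton_commute[of Y w b] mult_ac)
  qed
  have "(\<Sum>b\<in>Y. \<Sum>w\<in>Y - {b}. t b w) = (\<Sum>w\<in>Y. \<Sum>b\<in>Y - {w}. t b w)"
    by (rule sum_swap_off_diagonal) (rule Y(1))
  also have "\<dots> = (\<Sum>w\<in>Y. \<Sum>b\<in>Y - {w}. - t w b)"
    by (intro sum.cong refl anti) auto
  also have "\<dots> = - (\<Sum>w\<in>Y. \<Sum>b\<in>Y - {w}. t w b)" by (simp add: sum_negf)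
  finally have "2 * pfaffian_row A a X = 0" unfolding row by (metis add.right_inverse mult_2)
  then show ?thesis using two by simp
qed

text \<open>Expanding every Pfaffian with the larger index set along \<open>a\<close> turns the two halves of the sum
  into double sums that cancel because \<open>A\<close> is skew.\<close>

lemma pfaffian_bilinear:
  fixes A :: "'i::linorder \<Rightarrow> 'i \<Rightarrow> 'a::idom"
  assumes skew: "\<And>a b. A b a = - A a b" and two: "(2 :: 'a) \<noteq> 0" and X: "finite X" and Y: "finite Y"
  shows "(\<Sum>a\<in>X \<triangle> Y. position_sign a (X \<triangle> Y) * pfaffian A (X \<triangle> {a}) * pfaffian A (Y \<triangle> {a})) = 0"
proof -
  define t where "t = (\<lambda>X Y a. position_sign a X * pfaffian A (X - {a}) * pfaffian_row A a Y)"
  have half: "(\<Sum>a\<in>X. t X Y a) = (\<Sum>a\<in>X - Y. position_sign a (X \<triangle> Y) * pfaffian A (X \<triangle> {a}) * pfaffian A (Y \<triangle> {a}))"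
    if "finite X" "finite Y" for X Y
  proof -
    \<comment> \<open>Indices in both sets drop out because the row of \<open>a\<close> over a set
      containing \<open>a\<close> vanishes. Outside \<open>Y\<close> the row is, up to sign, the
      Pfaffian of \<open>insert a Y\<close>.\<close>
    have "(\<Sum>a\<in>X. t X Y a) = (\<Sum>a\<in>X - Y. t X Y a)"
      using that pfaffian_row_mem[of A, OF skew two] by (intro sum.mono_neutral_right) (auto simp: t_def)
    also have "\<dots> = (\<Sum>a\<in>X - Y. position_sign a (X \<triangle> Y) * pfaffian A (X \<triangle> {a}) * pfaffian A (Y \<triangle> {a}))"
    proof (rule sum.cong)
      fix a assume a: "a \<in> X - Y"
      then have "X \<triangle> {a} = X - {a}" "Y \<triangle> {a} = insert a Y" by auto
      then show "t X Y a = position_sign a (X \<triangle> Y) * pfaffian A (X \<triangle> {a}) * pfaffian A (Y \<triangle> {a})"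
        using that a pfaffian_row_insert[of A, OF skew, of Y a]
        by (simp add: t_def position_sign_symdiff mult_ac)
    qed simp
    finally show ?thesis .
  qed
  have full: "(\<Sum>a\<in>X. t X Y a) = (\<Sum>a\<in>X. \<Sum>b\<in>Y. position_sign a X * position_sign b Y *
      pfaffian A (X - {a}) * pfaffian A (Y - {b}) * A a b)" for X Y
    by (simp add: t_def pfaffian_row_def sum_distrib_left mult_ac)
  have "(\<Sum>a\<in>Y. t Y X a) = - (\<Sum>a\<in>X. t X Y a)"
  proof -
    have "(\<Sum>a\<in>Y. t Y X a) = (\<Sum>a\<in>X. \<Sum>b\<in>Y. - (position_sign a X * position_sign b Y *
      pfaffian A (X - {a}) * pfaffian A (Y - {b}) * A a b))"
      unfolding full
      by (subst sum.swap) (intro sum.cong refl, subst skew, simp add: mult_ac)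
    then show ?thesis unfolding full by (simp add: sum_negf)
  qed
  moreover have "(\<Sum>a\<in>X \<triangle> Y. position_sign a (X \<triangle> Y) * pfaffian A (X \<triangle> {a}) * pfaffian A (Y \<triangle> {a})) =
      (\<Sum>a\<in>X. t X Y a) + (\<Sum>a\<in>Y. t Y X a)"
  proof -
    have "Y \<triangle> X = X \<triangle> Y" by auto
    then show ?thesis
      unfolding half[OF X Y] half[OF Y X] using X Y
      by (subst sum.union_disjoint) (auto simp: mult_ac intro!: sum.cong)
  qed
  ultimately show ?thesis by simp
qed

text \<open>The border index \<open>- 1\<close> precedes all the indices \<open>0, 1, \<dots>\<close> that are used otherwise.\<close>

definition spin :: "(int \<Rightarrow> int \<Rightarrow> 'a::comm_ring_1) \<Rightarrow> int set \<Rightarrow> 'a" where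
  "spin A X = pfaffian A (if even (card X) then X else insert (- 1) X)"

lemma even_card_symdiff:
  assumes "finite X" "finite Y"
  shows "even (card (X \<triangle> Y)) \<longleftrightarrow> (even (card X) \<longleftrightarrow> even (card Y))"
proof -
  have "card X = card (X - Y) + card (X \<inter> Y)" "card Y = card (Y - X) + card (X \<inter> Y)"
    using assms by (auto simp: Int_commute card_Diff_subset_Int card_mono)
  moreover have "card (X \<triangle> Y) = card (X - Y) + card (Y - X)"
    using assms by (intro card_Un_disjoint) auto
  ultimately show ?thesis by auto
qed

text \<open>Each set is completed to even size by the border index, so toggling an odd set also
  toggles the border. The bilinear identity is applied to two completed sets that differ exactly in
  the border, \<open>x\<close>, \<open>y\<close> and \<open>z\<close>; it then has four terms, with
  alternating position signs.\<close>

lemma spin_relation: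
  fixes A :: "int \<Rightarrow> int \<Rightarrow> 'a::idom"
  assumes skew: "\<And>a b. A b a = - A a b" and two: "(2 :: 'a) \<noteq> 0"
    and X: "finite X" "\<And>a. a \<in> X \<Longrightarrow> 0 \<le> a" and xyz: "0 \<le> x" "x < y" "y < z"
  shows "spin A X * spin A (X \<triangle> {x, y, z}) =
    spin A (X \<triangle> {x}) * spin A (X \<triangle> {y, z}) - spin A (X \<triangle> {y}) * spin A (X \<triangle> {x, z})
      + spin A (X \<triangle> {z}) * spin A (X \<triangle> {x, y})"
proof -
  define E where "E = (\<lambda>Z. if even (card Z) then Z else insert (- 1) Z :: int set)"
  have spin: "spin A Z = pfaffian A (E Z)" for Z by (simp add: spin_def E_def)
  have E: "E (X \<triangle> Z) = E X \<triangle> (if even (card Z) then Z else insert (- 1) Z)"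
    if "finite Z" "Z \<subseteq> {x, y, z}" for Z
    using that X xyz even_card_symdiff[of X Z] by (auto simp: E_def; force)
  define I where "I = E X \<triangle> {- 1}"
  define J where "J = E X \<triangle> {x, y, z}"
  have IJ: "I \<triangle> J = {- 1, x, y, z}" using xyz by (auto simp: I_def J_def)
  have fin: "finite I" "finite J" using X by (auto simp: I_def J_def E_def)
  have sg: "position_sign (- 1) {- 1, x, y, z} = (1 :: 'a)" "position_sign x {- 1, x, y, z} = (- 1 :: 'a)"
      "position_sign y {- 1, x, y, z} = (1 :: 'a)" "position_sign z {- 1, x, y, z} = (- 1 :: 'a)"
    using xyz by (simp_all add: position_sign_insert before_sign_def position_sign_def)
  have sets: "I \<triangle> {- 1} = E X" "J \<triangle> {- 1} = E (X \<triangle> {x, y, z})"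
     "I \<triangle> {x} = E (X \<triangle> {x})" "J \<triangle> {x} = E (X \<triangle> {y, z})"
     "I \<triangle> {y} = E (X \<triangle> {y})" "J \<triangle> {y} = E (X \<triangle> {x, z})"
     "I \<triangle> {z} = E (X \<triangle> {z})" "J \<triangle> {z} = E (X \<triangle> {x, y})"
    using xyz by (auto simp: E I_def J_def)
  have "(\<Sum>a\<in>{- 1, x, y, z}. position_sign a {- 1, x, y, z} * pfaffian A (I \<triangle> {a}) * pfaffian A (J \<triangle> {a})) = 0"
    using pfaffian_bilinear[of A, OF skew two fin] unfolding IJ .
  also have "(\<Sum>a\<in>{- 1, x, y, z}. position_sign a {- 1, x, y, z} * pfaffian A (I \<triangle> {a}) * pfaffian A (J \<triangle> {a})) =
     pfaffian A (I \<triangle> {- 1}) * pfaffian A (J \<triangle> {- 1}) - pfaffian A (I \<triangle> {x}) * pfaffian A (J \<triangle> {x})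
      + pfaffian A (I \<triangle> {y}) * pfaffian A (J \<triangle> {y}) - pfaffian A (I \<triangle> {z}) * pfaffian A (J \<triangle> {z})"
    using xyz by (simp add: sg del: Un_insert_right Un_insert_left)
  finally show ?thesis unfolding sets spin by (simp add: algebra_simps)
qed

section \<open>Dependence on single entries, and interpolation of interval Pfaffians\<close>

lemma pfaffian_cong:
  assumes "\<And>a b. a \<in> X \<Longrightarrow> b \<in> X \<Longrightarrow> A a b = A' a b"
  shows "pfaffian A X = pfaffian A' X"
  using assms
proof (induction A X rule: pfaffian.induct)
  case (1 A X)
  show ?case
  proof (cases "finite X \<and> X \<noteq> {}")
    case True
    then have m: "Min X \<in> X" by simp
    have "pfaffian_row A (Min X) (X - {Min X}) = pfaffian_row A' (Min X) (X - {Min X})"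
      unfolding pfaffian_row_def
    proof (intro sum.cong refl, goal_cases)
      case (1 b)
      have "pfaffian A (X - {Min X} - {b}) = pfaffian A' (X - {Min X} - {b})"
        using True 1 by (intro "1.IH") (auto intro: "1.prems")
      moreover have "A (Min X) b = A' (Min X) b" using 1 m by (intro "1.prems") auto
      ultimately show ?case by simp
    qed
    then show ?thesis using True by (simp add: pfaffian_Min)
  next
    case False
    then show ?thesis by (subst (1 2) pfaffian.simps) auto
  qed
qed

text \<open>In the expansion along \<open>a\<close> only the term of \<open>b\<close> contains the
  changed entry, since all cofactors avoid \<open>a\<close>. So the Pfaffian is affine in this
  entry, and its slope is a signed Pfaffian of the remaining indices.\<close>

lemma pfaffian_update:
  fixes A :: "'i::linorder \<Rightarrow> 'i \<Rightarrow> 'a::comm_ring_1"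
  assumes skew: "\<And>a b. A b a = - A a b" "\<And>a b. A' b a = - A' a b"
    and X: "finite X" "a \<in> X" "b \<in> X" "a \<noteq> b"
    and agree: "\<And>u v. u \<in> X \<Longrightarrow> v \<in> X \<Longrightarrow> {u, v} \<noteq> {a, b} \<Longrightarrow> A' u v = A u v"
  shows "pfaffian A' X = pfaffian A X +
    position_sign a X * position_sign b (X - {a}) * (A' a b - A a b) * pfaffian A (X - {a} - {b})"
proof -
  have e: "pfaffian B X = position_sign a X * pfaffian_row B a (X - {a})"
    if "\<And>a b. B b a = - B a b" for B :: "'i \<Rightarrow> 'i \<Rightarrow> 'a"
    using pfaffian_expand[of B, OF that X(1,2)] by simp
  have eq: "pfaffian A' (X - {a} - {y}) = pfaffian A (X - {a} - {y})" for y
  proof (rule pfaffian_cong)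
    fix u v assume "u \<in> X - {a} - {y}" "v \<in> X - {a} - {y}"
    then show "A' u v = A u v" by (intro agree) (auto simp: doubleton_eq_iff)
  qed
  have "pfaffian_row A' a (X - {a}) - pfaffian_row A a (X - {a}) =
      (\<Sum>y\<in>X - {a}. position_sign y (X - {a}) * (A' a y - A a y) * pfaffian A (X - {a} - {y}))"
    unfolding pfaffian_row_def
    by (subst sum_subtractf[symmetric]) (intro sum.cong refl, simp add: eq algebra_simps)
  also have "\<dots> = (\<Sum>y\<in>{b}. position_sign y (X - {a}) * (A' a y - A a y) * pfaffian A (X - {a} - {y}))"
    using X agree[of a] by (intro sum.mono_neutral_right) (auto simp: doubleton_eq_iff)
  finally have row: "pfaffian_row A' a (X - {a}) = pfaffian_row A a (X - {a}) +
      position_sign b (X - {a}) * (A' a b - A a b) * pfaffian A (X - {a} - {b})"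
    by (simp add: algebra_simps)
  show ?thesis
    unfolding e[of A, OF skew(1)] e[of A', OF skew(2)] row by (simp add: algebra_simps)
qed

lemma spin_empty [simp]: "spin A {} = 1"
  by (simp add: spin_def)

lemma spin_singleton:
  fixes A :: "int \<Rightarrow> int \<Rightarrow> 'a::comm_ring_1"
  assumes "0 \<le> x"
  shows "spin A {x} = A (- 1) x"
proof -
  have "Min {- 1, x} = - 1" using assms by (intro Min_eqI) auto
  moreover have "{- 1, x} - {- 1} = {x}" using assms by auto
  ultimately have "pfaffian A {- 1, x} = pfaffian_row A (- 1) {x}"
    using pfaffian_Min[of "{- 1, x}" A] by simp
  then show ?thesis by (simp add: spin_def pfaffian_row_def position_sign_def)
qed

text \<open>Entries are chosen by increasing length of the interval. The entry joining the two ends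
  of an interval enters its Pfaffian linearly; the coefficient is, up to sign, the prescribed
  nonzero value of the interior. Shorter intervals do not contain both ends and keep their
  values.\<close>

lemma spin_interpolation:
  fixes c :: "int \<Rightarrow> int \<Rightarrow> 'a::field"
  assumes diag: "\<And>x. c x x = 1" and nz: "\<And>x y. 0 \<le> x \<Longrightarrow> x \<le> y \<Longrightarrow> y \<le> N \<Longrightarrow> c x y \<noteq> 0"
  obtains A where "\<And>a b. A b a = - A a b"
    and "\<And>x y. 0 \<le> x \<Longrightarrow> x \<le> y \<Longrightarrow> y \<le> N \<Longrightarrow> spin A {x..<y} = c x y"
proof -
  have "\<exists>A. (\<forall>a b. A b a = - A a b) \<and>
      (\<forall>x y. 0 \<le> x \<longrightarrow> x \<le> y \<longrightarrow> y \<le> N \<longrightarrow> y \<le> x + int d + 1 \<longrightarrow> spin A {x..<y} = c x y)" for d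
  proof (induction d)
    case 0
    \<comment> \<open>The border row realizes the values on singletons; entries between nonnegative
      indices start at 0.\<close>
    define A where "A = (\<lambda>a b :: int. if a = - 1 \<and> 0 \<le> b then c b (b + 1)
      else if b = - 1 \<and> 0 \<le> a then - c a (a + 1) else 0)"
    have spin: "spin A {x..<y} = c x y" if "0 \<le> x" "x \<le> y" "y \<le> x + 1" for x y
    proof (cases "x = y")
      case True
      then show ?thesis by (simp add: diag)
    next
      case False
      then have y: "y = x + 1" using that by simp
      then have "{x..<y} = {x}" by auto
      then show ?thesis using that(1) y by (simp add: spin_singleton A_def)
    qed
    have skew: "A b a = - A a b" for a b by (simp add: A_def)
    show ?case
    proof (intro exI[of _ A] conjI allI impI)
      show "A b a = - A a b" for a b by (rule skew)
    qed (use spin in simp)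
  next
    case (Suc d)
    then obtain A where skew: "\<And>a b. A b a = - A a b"
      and A: "\<And>x y. 0 \<le> x \<Longrightarrow> x \<le> y \<Longrightarrow> y \<le> N \<Longrightarrow> y \<le> x + int d + 1 \<Longrightarrow> spin A {x..<y} = c x y"
      by blast
    \<comment> \<open>The new intervals have length \<open>e + 1\<close>, so their ends, where
      entries change, are at distance \<open>e\<close>.\<close>
    define e where "e = int d + 1"
    define E where "E = (\<lambda>X. if even (card X) then X else insert (- 1) X :: int set)"
    have spin: "spin B X = pfaffian B (E X)" for B :: "int \<Rightarrow> int \<Rightarrow> 'a" and X
      by (simp add: spin_def E_def)
    define X where "X = (\<lambda>x. E {x..<x + e + 1})"
    define s :: "int \<Rightarrow> 'a" where "s = (\<lambda>x. position_sign x (X x) * position_sign (x + e) (X x - {x}))"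
    have ss: "s x * s x = 1" for x by (simp add: s_def mult_ac)
    \<comment> \<open>This solves the affine equation of \<open>pfaffian_update\<close> for the new
      entry; \<open>s x\<close> is its own inverse.\<close>
    define w where "w = (\<lambda>x. A x (x + e) + s x * (c x (x + e + 1) - pfaffian A (X x)) / c (x + 1) (x + e))"
    define B where "B = (\<lambda>a b. if 0 \<le> a \<and> b = a + e then w a else if 0 \<le> b \<and> a = b + e then - w b else A a b)"
    have skewB: "B b a = - B a b" for a b
      using skew[of a b] by (auto simp: B_def e_def)
    have "spin B {x..<y} = c x y" if xy: "0 \<le> x" "x \<le> y" "y \<le> N" "y \<le> x + int (Suc d) + 1" for x y
    proof (cases "y \<le> x + int d + 1")
      case True
      have "spin B {x..<y} = spin A {x..<y}"
        unfolding spin by (rule pfaffian_cong) (use True xy in \<open>auto simp: B_def E_def e_def split: if_splits\<close>)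
      then show ?thesis using A True xy by simp
    next
      case False
      then have y: "y = x + e + 1" using xy by (simp add: e_def)
      have mem: "finite (X x)" "x \<in> X x" "x + e \<in> X x" "x \<noteq> x + e"
        by (auto simp: X_def E_def e_def)
      have rest: "X x - {x} - {x + e} = E {x + 1..<x + e}"
      proof -
        have "card {x..<x + e + 1} = d + 2" "card {x + 1..<x + e} = d" by (simp_all add: e_def)
        then show ?thesis unfolding X_def E_def using xy(1) by (auto simp: e_def)
      qed
      have "pfaffian A (E {x + 1..<x + e}) = c (x + 1) (x + e)"
        using A[of "x + 1" "x + e"] xy y by (simp add: spin e_def)
      moreover have "c (x + 1) (x + e) \<noteq> 0" using nz[of "x + 1" "x + e"] xy y by (simp add: e_def)
      moreover have "pfaffian B (X x) = pfaffian A (X x) +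
          s x * (B x (x + e) - A x (x + e)) * pfaffian A (X x - {x} - {x + e})"
        unfolding s_def
        by (rule pfaffian_update[of A B, OF skew skewB mem])
          (auto simp: B_def X_def E_def e_def doubleton_eq_iff split: if_splits)
      ultimately have "pfaffian B (X x) = c x y"
        using xy(1) y by (simp add: rest B_def w_def ss flip: mult.assoc)
      then show ?thesis by (simp add: spin y X_def)
    qed
    then show ?case using skewB by (intro exI[of _ B] conjI allI impI)
  qed
  from this[of "nat N"] obtain A where skew: "\<And>a b. A b a = - A a b"
    and A: "\<And>x y. 0 \<le> x \<Longrightarrow> x \<le> y \<Longrightarrow> y \<le> N \<Longrightarrow> y \<le> x + int (nat N) + 1 \<Longrightarrow> spin A {x..<y} = c x y"
    by blast
  show thesis
  proof (rule that[of A])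
    show "A b a = - A a b" for a b by (rule skew)
  qed (use A in simp)
qed

section \<open>Subrings given as sets, and closure of Pfaffians in them\<close>

locale subring_set =
  fixes R :: "'a::comm_ring_1 set"
  assumes one_closed: "1 \<in> R"
    and uminus_closed: "a \<in> R \<Longrightarrow> - a \<in> R"
    and add_closed: "a \<in> R \<Longrightarrow> b \<in> R \<Longrightarrow> a + b \<in> R"
    and mult_closed: "a \<in> R \<Longrightarrow> b \<in> R \<Longrightarrow> a * b \<in> R"
begin

lemma zero_closed: "0 \<in> R"
  using add_closed[OF one_closed uminus_closed[OF one_closed]] by simp

lemma diff_closed: "a \<in> R \<Longrightarrow> b \<in> R \<Longrightarrow> a - b \<in> R"
  using add_closed[OF _ uminus_closed, of a b] by simp

lemma sum_closed: "(\<And>x. x \<in> X \<Longrightarrow> f x \<in> R) \<Longrightarrow> sum f X \<in> R"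
  by (induction X rule: infinite_finite_induct) (auto intro: zero_closed add_closed)

lemma position_sign_closed: "position_sign a X \<in> R"
  using position_sign_cases[of a X, where 'a = 'a] one_closed uminus_closed by auto

lemma pfaffian_closed: "(\<And>a b. a \<in> X \<Longrightarrow> b \<in> X \<Longrightarrow> a < b \<Longrightarrow> A a b \<in> R) \<Longrightarrow> pfaffian A X \<in> R"
proof (induction A X rule: pfaffian.induct)
  case (1 A X)
  show ?case
  proof (cases "finite X \<and> X \<noteq> {}")
    case True
    then have m: "Min X \<in> X" by simp
    have "pfaffian_row A (Min X) (X - {Min X}) \<in> R"
      unfolding pfaffian_row_def
    proof (rule sum_closed)
      fix b assume b: "b \<in> X - {Min X}"
      have "pfaffian A (X - {Min X} - {b}) \<in> R"
        using True b by (intro "1.IH") (auto intro: "1.prems")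
      moreover have "Min X \<le> b" using True b by simp
      then have "A (Min X) b \<in> R" using b m by (intro "1.prems") auto
      ultimately show "position_sign b (X - {Min X}) * A (Min X) b * pfaffian A (X - {Min X} - {b}) \<in> R"
        by (intro mult_closed position_sign_closed)
    qed
    then show ?thesis using True by (simp add: pfaffian_Min)
  next
    case False
    then show ?thesis by (subst pfaffian.simps) (auto intro: zero_closed one_closed)
  qed
qed

end

subsection \<open>Propagation of the cube relation\<close>

text \<open>The quotient is the signed number of integers congruent to \<open>x\<close> modulo
  \<open>m\<close> that are passed on the way from 0 to \<open>p\<close>. For nonnegative
  \<open>p\<close> it counts those in \<open>{0..<p}\<close>; rounding down makes it correct for
  negative \<open>p\<close> too.\<close>

definition crossings :: "int \<Rightarrow> int \<Rightarrow> int set" where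
  "crossings m p = {x \<in> {0..<m}. odd ((p + m - 1 - x) div m)}"

lemma finite_crossings [simp]: "finite (crossings m p)"
  by (rule finite_subset[of _ "{0..<m}"]) (auto simp: crossings_def)

lemma crossings_nonneg: "x \<in> crossings m p \<Longrightarrow> 0 \<le> x"
  by (simp add: crossings_def)

lemma crossings_initial:
  assumes "0 < m" "0 \<le> p" "p \<le> m"
  shows "crossings m p = {0..<p}"
proof -
  have "odd ((p + m - 1 - x) div m) \<longleftrightarrow> x < p" if "0 \<le> x" "x < m" for x
  proof (cases "x < p")
    case True
    then have "(p + m - 1 - x) div m = 1" using assms that by (intro int_div_pos_eq[of _ _ _ "p - 1 - x"]) auto
    then show ?thesis using True by simp
  next
    case False
    then have "(p + m - 1 - x) div m = 0" using assms that by (intro div_pos_pos_trivial) auto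
    then show ?thesis using False by simp
  qed
  then have "x \<in> crossings m p \<longleftrightarrow> x \<in> {0..<p}" for x
    using assms by (cases "0 \<le> x \<and> x < m") (simp add: crossings_def, auto simp: crossings_def)
  then show ?thesis by blast
qed

lemma crossings_add:
  assumes "0 < m"
  shows "crossings m (p + m) = crossings m p \<triangle> {0..<m}"
proof -
  have "(p + m + m - 1 - x) div m = (p + m - 1 - x) div m + 1" for x
    using assms div_add_self2[of m "p + m - 1 - x"] by (simp add: algebra_simps)
  then show ?thesis by (auto simp: crossings_def)
qed

lemma crossings_Suc:
  assumes "0 < m"
  shows "crossings m (p + 1) = crossings m p \<triangle> {p mod m}"
proof -
  have "odd ((p + 1 + m - 1 - x) div m) \<longleftrightarrow> (odd ((p + m - 1 - x) div m) \<longleftrightarrow> x \<noteq> p mod m)"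
    if x: "0 \<le> x" "x < m" for x
  proof -
    define q r where "q = p div m" and "r = p mod m"
    have p: "p = q * m + r" "0 \<le> r" "r < m" using assms by (auto simp: q_def r_def)
    consider "x < r" | "x = r" | "r < x" by linarith
    then show ?thesis
    proof cases
      case 1
      have "(p + 1 + m - 1 - x) div m = q + 1" "(p + m - 1 - x) div m = q + 1"
        by (rule int_div_pos_eq[of _ _ _ "r - x"] int_div_pos_eq[of _ _ _ "r - x - 1"]; use p x 1 in \<open>simp add: algebra_simps\<close>)+
      then show ?thesis using 1 r_def by simp
    next
      case 2
      have "(p + 1 + m - 1 - x) div m = q + 1" "(p + m - 1 - x) div m = q"
        by (rule int_div_pos_eq[of _ _ _ "0"] int_div_pos_eq[of _ _ _ "m - 1"]; use p x 2 assms in \<open>simp add: algebra_simps\<close>)+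
      then show ?thesis using 2 r_def by simp
    next
      case 3
      have "(p + 1 + m - 1 - x) div m = q" "(p + m - 1 - x) div m = q"
        by (rule int_div_pos_eq[of _ _ _ "m + r - x"] int_div_pos_eq[of _ _ _ "m + r - x - 1"]; use p x 3 in \<open>simp add: algebra_simps\<close>)+
      then show ?thesis using 3 r_def by simp
    qed
  qed
  then have "x \<in> crossings m (p + 1) \<longleftrightarrow> x \<in> crossings m p \<triangle> {p mod m}" for x
    using assms by (cases "0 \<le> x \<and> x < m") (simp add: crossings_def, auto simp: crossings_def)
  then show ?thesis by blast
qed

section \<open>Signs that turn the Pfaffian relation into the cube relation\<close>

definition parity_sign :: "int \<Rightarrow> 'a::comm_ring_1" where
  "parity_sign n = (if even n then 1 else - 1)"

lemma parity_sign_add: "parity_sign (a + b) = parity_sign a * parity_sign b"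
  by (auto simp: parity_sign_def)

lemma parity_sign_cong: "even (a - b) \<Longrightarrow> parity_sign a = parity_sign b"
  by (auto simp: parity_sign_def)

text \<open>The Pfaffian relation has a minus sign at the middle one of three indices.  No choice of signs
  depending on products of pairs of coordinates alone can remove it: the three parity conditions add
  up to a contradiction.  The indicator below, whose sum over four consecutive arguments is odd,
  repairs this.\<close>

definition three_mod_four :: "int \<Rightarrow> int" where
  "three_mod_four n = (if n mod 4 = 3 then 1 else 0)"

lemma three_mod_four_window:
  "three_mod_four n + three_mod_four (n + 1) + three_mod_four (n + 2) + three_mod_four (n + 3) = 1"
proof -
  have "(n + k) mod 4 = (n mod 4 + k) mod 4" for k by (simp add: mod_add_left_eq)
  moreover have "n mod 4 = 0 \<or> n mod 4 = 1 \<or> n mod 4 = 2 \<or> n mod 4 = 3" by presburger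
  ultimately show ?thesis by (elim disjE) (simp_all add: three_mod_four_def)
qed

text \<open>For even \<open>p\<close> the argument moves by a multiple of 4. For odd
  \<open>p\<close> it moves by 2 modulo 4, which changes the indicator exactly at odd
  \<open>n\<close>. This evaluates signs on the faces where two walkers coincide, so that their
  position enters the coordinate sum twice.\<close>

lemma three_mod_four_shift: "even (three_mod_four (n + 2 * p) - three_mod_four n - p * n)"
proof (cases "even p")
  case True
  then obtain k where "p = 2 * k" by (elim evenE)
  then have "three_mod_four (n + 2 * p) = three_mod_four n"
    unfolding three_mod_four_def by presburger
  then show ?thesis using True by simp
next
  case False
  then obtain k where "p = 2 * k + 1" by (elim oddE)
  then have "three_mod_four (n + 2 * p) = three_mod_four (n + 2)"
    unfolding three_mod_four_def by presburger
  moreover have "even (three_mod_four (n + 2) - three_mod_four n - n)"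
    unfolding three_mod_four_def by presburger
  ultimately show ?thesis using False by auto
qed

definition cube_exponent :: "int \<Rightarrow> int \<Rightarrow> int \<Rightarrow> int \<Rightarrow> int" where
  "cube_exponent c p r s = three_mod_four (p + r + s + c) + p * r + r * s"

text \<open>The products \<open>p * r\<close> and \<open>r * s\<close> together contribute 1, 2 and
  1 to the three differences, one for each pair of walkers that is separated. By the window identity
  the indicator adds the same odd number to each. What remains is even, odd, even, matching the
  minus sign at the middle index.\<close>

lemma cube_exponent_parity:
  shows "even (cube_exponent c (p + 1) (r + 1) (s + 1) + cube_exponent c p r s
      - (cube_exponent c (p + 1) r s + cube_exponent c p (r + 1) (s + 1)))"
    and "odd (cube_exponent c (p + 1) (r + 1) (s + 1) + cube_exponent c p r s
      - (cube_exponent c p (r + 1) s + cube_exponent c (p + 1) r (s + 1)))"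
    and "even (cube_exponent c (p + 1) (r + 1) (s + 1) + cube_exponent c p r s
      - (cube_exponent c p r (s + 1) + cube_exponent c (p + 1) (r + 1) s))"
proof -
  define n where "n = p + r + s + c"
  have sums: "p + 1 + (r + 1) + (s + 1) + c = n + 3" "p + r + s + c = n" "p + 1 + r + s + c = n + 1"
    "p + (r + 1) + (s + 1) + c = n + 2" "p + (r + 1) + s + c = n + 1" "p + 1 + r + (s + 1) + c = n + 2"
    "p + r + (s + 1) + c = n + 1" "p + 1 + (r + 1) + s + c = n + 2"
    by (simp_all add: n_def)
  have w: "three_mod_four (n + 1) + three_mod_four (n + 2) = 1 - three_mod_four n - three_mod_four (n + 3)"
    using three_mod_four_window[of n] by simp
  let ?k = "three_mod_four n + three_mod_four (n + 3)"
  have "cube_exponent c (p + 1) (r + 1) (s + 1) + cube_exponent c p r s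
      - (cube_exponent c (p + 1) r s + cube_exponent c p (r + 1) (s + 1)) = 2 * ?k"
    unfolding cube_exponent_def sums using w by (simp add: algebra_simps)
  then show "even (cube_exponent c (p + 1) (r + 1) (s + 1) + cube_exponent c p r s
      - (cube_exponent c (p + 1) r s + cube_exponent c p (r + 1) (s + 1)))" by simp
  have "cube_exponent c (p + 1) (r + 1) (s + 1) + cube_exponent c p r s
      - (cube_exponent c p (r + 1) s + cube_exponent c (p + 1) r (s + 1)) = 2 * ?k + 1"
    unfolding cube_exponent_def sums using w by (simp add: algebra_simps)
  then show "odd (cube_exponent c (p + 1) (r + 1) (s + 1) + cube_exponent c p r s
      - (cube_exponent c p (r + 1) s + cube_exponent c (p + 1) r (s + 1)))" by simp
  have "cube_exponent c (p + 1) (r + 1) (s + 1) + cube_exponent c p r s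
      - (cube_exponent c p r (s + 1) + cube_exponent c (p + 1) (r + 1) s) = 2 * ?k"
    unfolding cube_exponent_def sums using w by (simp add: algebra_simps)
  then show "even (cube_exponent c (p + 1) (r + 1) (s + 1) + cube_exponent c p r s
      - (cube_exponent c p r (s + 1) + cube_exponent c (p + 1) (r + 1) s))" by simp
qed

definition cube_relation :: "(int \<Rightarrow> int \<Rightarrow> int \<Rightarrow> 'a::comm_ring_1) \<Rightarrow> int \<Rightarrow> int \<Rightarrow> int \<Rightarrow> bool" where
  "cube_relation F p r s \<longleftrightarrow>
     F (p + 1) (r + 1) (s + 1) * F p r s =
       F (p + 1) r s * F p (r + 1) (s + 1) + F p (r + 1) s * F (p + 1) r (s + 1)
       + F p r (s + 1) * F (p + 1) (r + 1) s"

text \<open>Between 0 and \<open>m\<close> a step of a walker toggles its own position, so the order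
  of the walkers is the order of the indices in \<open>spin_relation\<close>. Exponents linear in
  the coordinates have the same total in every product; this freedom and the constant set
  \<open>C\<close> serve to fit different blocks of the prism.\<close>

lemma cube_relation_spin:
  fixes A :: "int \<Rightarrow> int \<Rightarrow> 'a::idom"
  assumes skew: "\<And>a b. A b a = - A a b" and two: "(2 :: 'a) \<noteq> 0" and m: "0 < m"
    and C: "finite C" "\<And>x. x \<in> C \<Longrightarrow> 0 \<le> x" and prs: "0 \<le> p" "p < r" "r < s" "s < m"
  shows "cube_relation (\<lambda>p r s. parity_sign (cube_exponent c p r s + i * p + j * r + k * s) *
      spin A (crossings m p \<triangle> crossings m r \<triangle> crossings m s \<triangle> C)) p r s"
proof -
  define X where "X = crossings m p \<triangle> crossings m r \<triangle> crossings m s \<triangle> C"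
  have X: "finite X" "\<And>x. x \<in> X \<Longrightarrow> 0 \<le> x"
    using C by (auto simp: X_def dest: crossings_nonneg)
  have suc: "crossings m (p + 1) = crossings m p \<triangle> {p}" "crossings m (r + 1) = crossings m r \<triangle> {r}"
     "crossings m (s + 1) = crossings m s \<triangle> {s}"
    using prs m by (simp_all add: crossings_Suc)
  define q where "q = (\<lambda>p r s. cube_exponent c p r s + i * p + j * r + k * s)"
  define e where "e = q (p + 1) (r + 1) (s + 1) + q p r s"
  have sets: "crossings m (p + 1) \<triangle> crossings m r \<triangle> crossings m s \<triangle> C = X \<triangle> {p}"
    "crossings m p \<triangle> crossings m (r + 1) \<triangle> crossings m s \<triangle> C = X \<triangle> {r}"
    "crossings m p \<triangle> crossings m r \<triangle> crossings m (s + 1) \<triangle> C = X \<triangle> {s}"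
    "crossings m p \<triangle> crossings m (r + 1) \<triangle> crossings m (s + 1) \<triangle> C = X \<triangle> {r, s}"
    "crossings m (p + 1) \<triangle> crossings m r \<triangle> crossings m (s + 1) \<triangle> C = X \<triangle> {p, s}"
    "crossings m (p + 1) \<triangle> crossings m (r + 1) \<triangle> crossings m s \<triangle> C = X \<triangle> {p, r}"
    "crossings m (p + 1) \<triangle> crossings m (r + 1) \<triangle> crossings m (s + 1) \<triangle> C = X \<triangle> {p, r, s}"
    unfolding suc X_def using prs by auto
  have par: "parity_sign (q (p + 1) r s) * parity_sign (q p (r + 1) (s + 1)) = (parity_sign e :: 'a)"
    "parity_sign (q p (r + 1) s) * parity_sign (q (p + 1) r (s + 1)) = (- parity_sign e :: 'a)"
    "parity_sign (q p r (s + 1)) * parity_sign (q (p + 1) (r + 1) s) = (parity_sign e :: 'a)"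
  proof -
    have "e - (q (p + 1) r s + q p (r + 1) (s + 1)) =
        cube_exponent c (p + 1) (r + 1) (s + 1) + cube_exponent c p r s
          - (cube_exponent c (p + 1) r s + cube_exponent c p (r + 1) (s + 1))"
      "e - (q p (r + 1) s + q (p + 1) r (s + 1)) =
        cube_exponent c (p + 1) (r + 1) (s + 1) + cube_exponent c p r s
          - (cube_exponent c p (r + 1) s + cube_exponent c (p + 1) r (s + 1))"
      "e - (q p r (s + 1) + q (p + 1) (r + 1) s) =
        cube_exponent c (p + 1) (r + 1) (s + 1) + cube_exponent c p r s
          - (cube_exponent c p r (s + 1) + cube_exponent c (p + 1) (r + 1) s)"
      by (simp_all add: e_def q_def algebra_simps)
    then have "even (e - (q (p + 1) r s + q p (r + 1) (s + 1)))"
      "odd (e - (q p (r + 1) s + q (p + 1) r (s + 1)))"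
      "even (e - (q p r (s + 1) + q (p + 1) (r + 1) s))"
      using cube_exponent_parity[of c p r s] by metis+
    then show "parity_sign (q (p + 1) r s) * parity_sign (q p (r + 1) (s + 1)) = (parity_sign e :: 'a)"
      "parity_sign (q p (r + 1) s) * parity_sign (q (p + 1) r (s + 1)) = (- parity_sign e :: 'a)"
      "parity_sign (q p r (s + 1)) * parity_sign (q (p + 1) (r + 1) s) = (parity_sign e :: 'a)"
      unfolding parity_sign_add[symmetric] by (auto simp: parity_sign_def)
  qed
  have sign: "parity_sign (q (p + 1) (r + 1) (s + 1)) * parity_sign (q p r s) = (parity_sign e :: 'a)"
    by (simp add: e_def parity_sign_add)
  have regroup: "u * x * (v * y) = w * (x * y)" if "u * v = w" for u v w x y :: 'a
    unfolding that[symmetric] by (simp only: mult_ac)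
  have q: "cube_exponent c p r s + i * p + j * r + k * s = q p r s" for p r s
    by (simp add: q_def)
  have rel: "spin A X * spin A (X \<triangle> {p, r, s}) =
    spin A (X \<triangle> {p}) * spin A (X \<triangle> {r, s}) - spin A (X \<triangle> {r}) * spin A (X \<triangle> {p, s})
      + spin A (X \<triangle> {s}) * spin A (X \<triangle> {p, r})"
    using prs by (intro spin_relation[of A, OF skew two X]) auto
  have "parity_sign e * (spin A (X \<triangle> {p, r, s}) * spin A X) =
     parity_sign e * (spin A (X \<triangle> {p}) * spin A (X \<triangle> {r, s})) +
     - parity_sign e * (spin A (X \<triangle> {r}) * spin A (X \<triangle> {p, s})) +
     parity_sign e * (spin A (X \<triangle> {s}) * spin A (X \<triangle> {p, r}))"
    using arg_cong[OF rel, of "(*) (parity_sign e)"] by (simp add: algebra_simps)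
  then show ?thesis
    unfolding cube_relation_def q sets X_def[symmetric] par[THEN regroup] sign[THEN regroup] .
qed

text \<open>The relation at \<open>(p, r - 1, s - 1)\<close> expresses the value at
  \<open>(p + 1, r, s)\<close> through the wall \<open>p\<close> and values on the new wall with
  smaller \<open>r + s\<close>. The divisor lies on the wall \<open>p\<close>.\<close>

lemma cube_relation_unique_step:
  fixes F G :: "int \<Rightarrow> int \<Rightarrow> int \<Rightarrow> 'a::idom"
  assumes base: "\<And>r s. p \<le> r \<Longrightarrow> r \<le> s \<Longrightarrow> s \<le> N \<Longrightarrow> F p r s = G p r s"
    and nz: "\<And>r s. p \<le> r \<Longrightarrow> r \<le> s \<Longrightarrow> s \<le> N \<Longrightarrow> F p r s \<noteq> 0"
    and F: "\<And>r s. p < r \<Longrightarrow> r < s \<Longrightarrow> s < N \<Longrightarrow> cube_relation F p r s"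
    and G: "\<And>r s. p < r \<Longrightarrow> r < s \<Longrightarrow> s < N \<Longrightarrow> cube_relation G p r s"
    and left: "\<And>s. p + 1 \<le> s \<Longrightarrow> s \<le> N \<Longrightarrow> F (p + 1) (p + 1) s = G (p + 1) (p + 1) s"
    and diag: "\<And>r. p + 1 \<le> r \<Longrightarrow> r \<le> N \<Longrightarrow> F (p + 1) r r = G (p + 1) r r"
    and rs: "p + 1 \<le> r" "r \<le> s" "s \<le> N"
  shows "F (p + 1) r s = G (p + 1) r s"
  using rs
proof (induction "nat (r + s - 2 * p)" arbitrary: r s rule: less_induct)
  case less
  consider "r = p + 1" | "r = s" | "p < r - 1" "r - 1 < s - 1" using less.prems by linarith
  then show ?case
  proof cases
    case 3
    have IH: "F (p + 1) (r - 1) (s - 1) = G (p + 1) (r - 1) (s - 1)"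
      "F (p + 1) (r - 1) s = G (p + 1) (r - 1) s" "F (p + 1) r (s - 1) = G (p + 1) r (s - 1)"
      by (rule less.hyps; use 3 less.prems in simp)+
    have eq: "F p (r - 1) (s - 1) = G p (r - 1) (s - 1)" "F p r s = G p r s" "F p r (s - 1) = G p r (s - 1)"
        "F p (r - 1) s = G p (r - 1) s"
      by (rule base; use 3 less.prems in simp)+
    have "cube_relation F p (r - 1) (s - 1)" "cube_relation G p (r - 1) (s - 1)"
      using F G 3 less.prems by simp_all
    then have "F (p + 1) r s * G p (r - 1) (s - 1) = G (p + 1) r s * G p (r - 1) (s - 1)"
      unfolding cube_relation_def by (simp add: IH eq)
    moreover have "G p (r - 1) (s - 1) \<noteq> 0" using nz[of "r - 1" "s - 1"] eq 3 less.prems by simp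
    ultimately show ?thesis by simp
  qed (use less.prems left diag in auto)
qed

lemma cube_relation_unique:
  fixes F G :: "int \<Rightarrow> int \<Rightarrow> int \<Rightarrow> 'a::idom"
  assumes base: "\<And>r s. 0 \<le> r \<Longrightarrow> r \<le> s \<Longrightarrow> s \<le> N \<Longrightarrow> F 0 r s = G 0 r s"
    and nz: "\<And>p r s. 0 \<le> p \<Longrightarrow> p \<le> r \<Longrightarrow> r \<le> s \<Longrightarrow> s \<le> N \<Longrightarrow> F p r s \<noteq> 0"
    and F: "\<And>p r s. 0 \<le> p \<Longrightarrow> p < r \<Longrightarrow> r < s \<Longrightarrow> s < N \<Longrightarrow> cube_relation F p r s"
    and G: "\<And>p r s. 0 \<le> p \<Longrightarrow> p < r \<Longrightarrow> r < s \<Longrightarrow> s < N \<Longrightarrow> cube_relation G p r s"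
    and left: "\<And>p s. 0 \<le> p \<Longrightarrow> p \<le> s \<Longrightarrow> s \<le> N \<Longrightarrow> F p p s = G p p s"
    and diag: "\<And>p r. 0 \<le> p \<Longrightarrow> p \<le> r \<Longrightarrow> r \<le> N \<Longrightarrow> F p r r = G p r r"
    and prs: "0 \<le> p" "p \<le> r" "r \<le> s" "s \<le> N"
  shows "F p r s = G p r s"
  using prs
proof (induction p arbitrary: r s rule: int_ge_induct)
  case base
  then show ?case using assms(1) by simp
next
  case (step p)
  show ?case
  proof (rule cube_relation_unique_step[of p N F G])
    show "F p r s = G p r s" if "p \<le> r" "r \<le> s" "s \<le> N" for r s
      using that by (rule step.IH)
    show "F p r s \<noteq> 0" if "p \<le> r" "r \<le> s" "s \<le> N" for r s
      using step.hyps that by (rule nz)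
    show "cube_relation F p r s" "cube_relation G p r s" if "p < r" "r < s" "s < N" for r s
      using step.hyps that by (rule F, rule G)
    show "F (p + 1) (p + 1) s = G (p + 1) (p + 1) s" if "p + 1 \<le> s" "s \<le> N" for s
      using step.hyps that by (intro left) simp_all
    show "F (p + 1) r r = G (p + 1) r r" if "p + 1 \<le> r" "r \<le> N" for r
      using step.hyps that by (intro diag) simp_all
  qed (rule step.prems)+
qed

section \<open>Parametrization of the prism by one skew matrix, and periodicity\<close>

locale prism =
  fixes m :: int and F :: "int \<Rightarrow> int \<Rightarrow> int \<Rightarrow> 'a::field"
  assumes m_pos: "0 < m"
    and two_nonzero: "(2 :: 'a) \<noteq> 0"
    and F_nonzero: "\<And>p r s. p \<le> r \<Longrightarrow> r \<le> s \<Longrightarrow> s \<le> p + m \<Longrightarrow> F p r s \<noteq> 0"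
    and F_left: "\<And>p s. p \<le> s \<Longrightarrow> s \<le> p + m \<Longrightarrow> F p p s = 1"
    and F_right: "\<And>p r. p \<le> r \<Longrightarrow> r \<le> p + m \<Longrightarrow> F p r r = 1"
    and F_top: "\<And>p r. p \<le> r \<Longrightarrow> r \<le> p + m \<Longrightarrow> F p r (p + m) = 1"
    and F_cube: "\<And>p r s. p < r \<Longrightarrow> r < s \<Longrightarrow> s < p + m \<Longrightarrow> cube_relation F p r s"
begin

text \<open>Two blocks are covered: all walkers between 0 and \<open>m\<close>, and the last walker
  past \<open>m\<close> by \<open>u\<close>. The matrix is fitted to the wall \<open>p = 0\<close>;
  uniqueness extends the formula to the first block, whose face \<open>s = m\<close> then starts the
  second. On the other faces coinciding walkers leave an initial or final segment, whose Pfaffian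
  the wall already fixes.\<close>

lemma spin_parametrization:
  obtains A where "\<And>a b. A b a = - A a b"
    and "\<And>p r s. 0 \<le> p \<Longrightarrow> p \<le> r \<Longrightarrow> r \<le> s \<Longrightarrow> s \<le> m \<Longrightarrow>
      F p r s = parity_sign (cube_exponent 0 p r s + r) *
        spin A (crossings m p \<triangle> crossings m r \<triangle> crossings m s)"
    and "\<And>u p r. 0 \<le> u \<Longrightarrow> u \<le> p \<Longrightarrow> p \<le> r \<Longrightarrow> r \<le> m \<Longrightarrow>
      F p r (u + m) = parity_sign (cube_exponent m u p r + (m + 1) * u + (m + 1) * r) *
        spin A (crossings m u \<triangle> crossings m p \<triangle> crossings m r \<triangle> crossings m m)"
proof -
  \<comment> \<open>Walkers at \<open>r\<close> and \<open>s\<close> jointly cross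
    \<open>{r..<s}\<close>, so these are the wall values with the sign removed. The case
    \<open>r = s\<close> is set to 1 separately because the interpolation asks for it at every
    integer, even outside the prism.\<close>
  define c where "c = (\<lambda>r s. if r = s then 1 else parity_sign (cube_exponent 0 0 r s + r) * F 0 r s)"
  have "c r s \<noteq> 0" if "0 \<le> r" "r \<le> s" "s \<le> m" for r s
    using that F_nonzero[of 0 r s] by (simp add: c_def parity_sign_def)
  then obtain A where skew: "\<And>a b. A b a = - A a b"
    and A: "\<And>r s. 0 \<le> r \<Longrightarrow> r \<le> s \<Longrightarrow> s \<le> m \<Longrightarrow> spin A {r..<s} = c r s"
    using spin_interpolation[of c m] unfolding c_def by metis
  have interval: "crossings m r \<triangle> crossings m s = {r..<s}" if "0 \<le> r" "r \<le> s" "s \<le> m" for r s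
    using that m_pos by (auto simp: crossings_initial)
  have even_c: "even (cube_exponent 0 0 r r + r)" for r
    using three_mod_four_shift[of 0 r] by (simp add: cube_exponent_def three_mod_four_def; presburger)
  have F0: "F 0 r s = parity_sign (cube_exponent 0 0 r s + r) * spin A (crossings m r \<triangle> crossings m s)"
    if "0 \<le> r" "r \<le> s" "s \<le> m" for r s
    using that A[OF that] F_right[of 0 r] even_c[of r]
    by (auto simp: interval c_def parity_sign_def)
  have cr0: "crossings m 0 = {}" using m_pos by (simp add: crossings_initial)
  \<comment> \<open>The edges \<open>r = 0\<close> and \<open>s = m\<close> of the wall carry the
    value 1, which fixes the Pfaffians of initial and final segments.\<close>
  have initial: "parity_sign (three_mod_four s) * spin A (crossings m s) = 1" if "0 \<le> s" "s \<le> m" for s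
    using F0[of 0 s] F_left[of 0 s] that by (simp add: cr0 cube_exponent_def)
  have final: "parity_sign (three_mod_four (r + m) + r * m + r) * spin A (crossings m r \<triangle> crossings m m) = 1"
    if "0 \<le> r" "r \<le> m" for r
    using F0[of r m] F_top[of 0 r] that by (simp add: cube_exponent_def)
  define G where "G = (\<lambda>p r s. parity_sign (cube_exponent 0 p r s + 0 * p + 1 * r + 0 * s) *
        spin A (crossings m p \<triangle> crossings m r \<triangle> crossings m s \<triangle> {}))"
  have FG: "F p r s = G p r s" if "0 \<le> p" "p \<le> r" "r \<le> s" "s \<le> m" for p r s
    using _ _ _ _ _ _ that
  proof (rule cube_relation_unique)
    show "F 0 r s = G 0 r s" if "0 \<le> r" "r \<le> s" "s \<le> m" for r s
      using F0[OF that] by (simp add: G_def cr0)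
    show "F p r s \<noteq> 0" if "0 \<le> p" "p \<le> r" "r \<le> s" "s \<le> m" for p r s
      using that by (intro F_nonzero) auto
    show "cube_relation F p r s" if "0 \<le> p" "p < r" "r < s" "s < m" for p r s
      using that by (intro F_cube) auto
    show "cube_relation G p r s" if "0 \<le> p" "p < r" "r < s" "s < m" for p r s
      unfolding G_def using that by (intro cube_relation_spin[of A, OF skew two_nonzero m_pos]) auto
    show "F p p s = G p p s" if "0 \<le> p" "p \<le> s" "s \<le> m" for p s
    proof -
      have "even (cube_exponent 0 p p s + p - three_mod_four s)"
        using three_mod_four_shift[of s p] by (simp add: cube_exponent_def algebra_simps) argo
      then have "parity_sign (cube_exponent 0 p p s + p) = (parity_sign (three_mod_four s) :: 'a)"
        by (rule parity_sign_cong)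
      then show ?thesis using initial[of s] F_left[of p s] that by (simp add: G_def)
    qed
    show "F p r r = G p r r" if "0 \<le> p" "p \<le> r" "r \<le> m" for p r
    proof -
      have "even (cube_exponent 0 p r r + r - three_mod_four p)"
        using three_mod_four_shift[of p r] by (simp add: cube_exponent_def algebra_simps) argo
      then have "parity_sign (cube_exponent 0 p r r + r) = (parity_sign (three_mod_four p) :: 'a)"
        by (rule parity_sign_cong)
      moreover have "crossings m p \<triangle> crossings m r \<triangle> crossings m r \<triangle> {} = crossings m p" by auto
      ultimately show ?thesis using initial[of p] F_right[of p r] that by (simp add: G_def)
    qed
  qed
  \<comment> \<open>At \<open>u = 0\<close> the exponent has to agree with that of \<open>G\<close>
    at \<open>s = m\<close>, where \<open>r * s\<close> becomes \<open>r * m\<close>; hence the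
    coefficient \<open>m + 1\<close> of \<open>r\<close>. The coefficient of \<open>u\<close> gives
    the right sign on the faces with coinciding walkers.\<close>
  define H where "H = (\<lambda>u p r. parity_sign (cube_exponent m u p r + (m + 1) * u + 0 * p + (m + 1) * r) *
        spin A (crossings m u \<triangle> crossings m p \<triangle> crossings m r \<triangle> crossings m m))"
  \<comment> \<open>The walker beyond \<open>m\<close> is relabelled as the first one; this only
    permutes the products in the cube relation.\<close>
  define F' where "F' = (\<lambda>u p r. F p r (u + m))"
  have F'H: "F' u p r = H u p r" if "0 \<le> u" "u \<le> p" "p \<le> r" "r \<le> m" for u p r
    using _ _ _ _ _ _ that
  proof (rule cube_relation_unique)
    show "F' 0 p r = H 0 p r" if "0 \<le> p" "p \<le> r" "r \<le> m" for p r
    proof -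
      have "even (cube_exponent 0 p r m + r - (cube_exponent m 0 p r + (m + 1) * r))"
        by (simp add: cube_exponent_def algebra_simps)
      then have "parity_sign (cube_exponent 0 p r m + r) = (parity_sign (cube_exponent m 0 p r + (m + 1) * r) :: 'a)"
        by (rule parity_sign_cong)
      then show ?thesis using FG[of p r m] that by (simp add: F'_def H_def G_def cr0)
    qed
    show "F' u p r \<noteq> 0" if "0 \<le> u" "u \<le> p" "p \<le> r" "r \<le> m" for u p r
      unfolding F'_def using that by (intro F_nonzero) auto
    show "cube_relation F' u p r" if "0 \<le> u" "u < p" "p < r" "r < m" for u p r
      using F_cube[of p r "u + m"] that unfolding F'_def cube_relation_def by (simp add: algebra_simps)
    show "cube_relation H u p r" if "0 \<le> u" "u < p" "p < r" "r < m" for u p r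
      unfolding H_def using that
      by (intro cube_relation_spin[of A, OF skew two_nonzero m_pos]) (auto dest: crossings_nonneg)
    show "F' u u r = H u u r" if "0 \<le> u" "u \<le> r" "r \<le> m" for u r
    proof -
      have "even (cube_exponent m u u r + (m + 1) * u + (m + 1) * r - (three_mod_four (r + m) + r * m + r))"
        using three_mod_four_shift[of "r + m" u] by (simp add: cube_exponent_def algebra_simps) argo
      then have "parity_sign (cube_exponent m u u r + (m + 1) * u + (m + 1) * r) =
          (parity_sign (three_mod_four (r + m) + r * m + r) :: 'a)"
        by (rule parity_sign_cong)
      then show ?thesis using final[of r] F_top[of u r] that by (simp add: H_def F'_def)
    qed
    show "F' u p p = H u p p" if "0 \<le> u" "u \<le> p" "p \<le> m" for u p
    proof -
      have "even (cube_exponent m u p p + (m + 1) * u + (m + 1) * p - (three_mod_four (u + m) + u * m + u))"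
        using three_mod_four_shift[of "u + m" p] by (simp add: cube_exponent_def algebra_simps) argo
      then have "parity_sign (cube_exponent m u p p + (m + 1) * u + (m + 1) * p) =
          (parity_sign (three_mod_four (u + m) + u * m + u) :: 'a)"
        by (rule parity_sign_cong)
      moreover have "crossings m u \<triangle> crossings m p \<triangle> crossings m p \<triangle> crossings m m = crossings m u \<triangle> crossings m m"
        by auto
      ultimately show ?thesis using final[of u] F_left[of p "u + m"] that by (simp add: H_def F'_def)
    qed
  qed
  show thesis
  proof (rule that[of A])
    show "A b a = - A a b" for a b by (rule skew)
    show "F p r s = parity_sign (cube_exponent 0 p r s + r) *
        spin A (crossings m p \<triangle> crossings m r \<triangle> crossings m s)"
      if "0 \<le> p" "p \<le> r" "r \<le> s" "s \<le> m" for p r s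
      using FG[OF that] by (simp add: G_def)
    show "F p r (u + m) = parity_sign (cube_exponent m u p r + (m + 1) * u + (m + 1) * r) *
        spin A (crossings m u \<triangle> crossings m p \<triangle> crossings m r \<triangle> crossings m m)"
      if "0 \<le> u" "u \<le> p" "p \<le> r" "r \<le> m" for u p r
      using F'H[OF that] by (simp add: H_def F'_def)
  qed
qed

text \<open>The left point lies in the second block of the parametrization, the right one on the
  wall \<open>p = 0\<close>. Their crossed sets coincide because two copies of
  \<open>crossings m m\<close> cancel, and \<open>three_mod_four_shift\<close> shows that the
  exponents have equal parity.\<close>

lemma turn_initial:
  assumes "0 \<le> u" "u \<le> p" "p \<le> m"
  shows "F p m (u + m) = F 0 u p"
proof -
  obtain A where A: "\<And>p r s. 0 \<le> p \<Longrightarrow> p \<le> r \<Longrightarrow> r \<le> s \<Longrightarrow> s \<le> m \<Longrightarrow>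
      F p r s = parity_sign (cube_exponent 0 p r s + r) *
        spin A (crossings m p \<triangle> crossings m r \<triangle> crossings m s)"
    "\<And>u p r. 0 \<le> u \<Longrightarrow> u \<le> p \<Longrightarrow> p \<le> r \<Longrightarrow> r \<le> m \<Longrightarrow>
      F p r (u + m) = parity_sign (cube_exponent m u p r + (m + 1) * u + (m + 1) * r) *
        spin A (crossings m u \<triangle> crossings m p \<triangle> crossings m r \<triangle> crossings m m)"
    using spin_parametrization by metis
  have "crossings m u \<triangle> crossings m p \<triangle> crossings m m \<triangle> crossings m m = crossings m 0 \<triangle> crossings m u \<triangle> crossings m p"
    using m_pos by (auto simp: crossings_initial)
  moreover have "even (cube_exponent m u p m + (m + 1) * u + (m + 1) * m - (cube_exponent 0 0 u p + u))"
    using three_mod_four_shift[of "u + p" m] by (simp add: cube_exponent_def algebra_simps)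
  then have "parity_sign (cube_exponent m u p m + (m + 1) * u + (m + 1) * m) =
      (parity_sign (cube_exponent 0 0 u p + u) :: 'a)"
    by (rule parity_sign_cong)
  ultimately show ?thesis using A(1)[of 0 u p] A(2)[of u p m] assms by simp
qed

text \<open>Translating all walkers preserves the assumptions, so \<open>turn_initial\<close>, which
  starts at the wall 0, can be used from any position.\<close>

lemma prism_shift: "prism m (\<lambda>p r s. F (p + n) (r + n) (s + n))"
proof
  show "cube_relation (\<lambda>p r s. F (p + n) (r + n) (s + n)) p r s" if "p < r" "r < s" "s < p + m" for p r s
    using F_cube[of "p + n" "r + n" "s + n"] that by (simp add: cube_relation_def add_ac)
  show "F (p + n) (r + n) (p + m + n) = 1" if "p \<le> r" "r \<le> p + m" for p r
    using F_top[of "p + n" "r + n"] that by (simp add: add_ac)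
  show "F (p + n) (r + n) (s + n) \<noteq> 0" if "p \<le> r" "r \<le> s" "s \<le> p + m" for p r s
    using that by (intro F_nonzero) auto
qed (use m_pos two_nonzero in \<open>auto intro!: F_left F_right\<close>)

lemma turn:
  assumes "p \<le> r" "r \<le> s" "s \<le> p + m"
  shows "F s (p + m) (r + m) = F p r s"
  using prism.turn_initial[OF prism_shift, of "r - p" "s - p" p] assms by (simp add: algebra_simps)

text \<open>One matrix serves the whole prism: a turn changes neither \<open>F\<close> nor the
  crossed set, so the claim spreads from the two blocks. Three turns translate by
  \<open>2 * m\<close>, which reduces every point to one with \<open>p\<close> in
  \<open>{0..<2 * m}\<close>.\<close>

lemma spin_parametrization_up_to_sign:
  obtains A where "\<And>a b. A b a = - A a b"
    and "\<And>p r s. p \<le> r \<Longrightarrow> r \<le> s \<Longrightarrow> s \<le> p + m \<Longrightarrow>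
      F p r s \<in> {spin A (crossings m p \<triangle> crossings m r \<triangle> crossings m s),
        - spin A (crossings m p \<triangle> crossings m r \<triangle> crossings m s)}"
proof -
  obtain A where skew: "\<And>a b. A b a = - A a b"
    and A: "\<And>p r s. 0 \<le> p \<Longrightarrow> p \<le> r \<Longrightarrow> r \<le> s \<Longrightarrow> s \<le> m \<Longrightarrow>
      F p r s = parity_sign (cube_exponent 0 p r s + r) *
        spin A (crossings m p \<triangle> crossings m r \<triangle> crossings m s)"
    "\<And>u p r. 0 \<le> u \<Longrightarrow> u \<le> p \<Longrightarrow> p \<le> r \<Longrightarrow> r \<le> m \<Longrightarrow>
      F p r (u + m) = parity_sign (cube_exponent m u p r + (m + 1) * u + (m + 1) * r) *
        spin A (crossings m u \<triangle> crossings m p \<triangle> crossings m r \<triangle> crossings m m)"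
    using spin_parametrization by metis
  define T where "T = (\<lambda>p r s. crossings m p \<triangle> crossings m r \<triangle> crossings m s)"
  define E where "E = (\<lambda>p r s. F p r s \<in> {spin A (T p r s), - spin A (T p r s)})"
  have D0: "E p r s" if "0 \<le> p" "p \<le> r" "r \<le> s" "s \<le> m" for p r s
    using A(1)[OF that] unfolding E_def T_def by (simp add: parity_sign_def)
  have D1: "E p r (u + m)" if "0 \<le> u" "u \<le> p" "p \<le> r" "r \<le> m" for u p r
  proof -
    have "T p r (u + m) = crossings m u \<triangle> crossings m p \<triangle> crossings m r \<triangle> crossings m m"
      using m_pos unfolding T_def by (simp only: crossings_add crossings_initial order_refl less_imp_le) auto
    then show ?thesis using A(2)[OF that] unfolding E_def by (simp add: parity_sign_def)
  qed
  have turn: "E s (p + m) (r + m) \<longleftrightarrow> E p r s" if "p \<le> r" "r \<le> s" "s \<le> p + m" for p r s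
  proof -
    have "T s (p + m) (r + m) = T p r s"
      using m_pos unfolding T_def by (simp only: crossings_add) auto
    then show ?thesis unfolding E_def turn[OF that] by simp
  qed
  have E0: "E p r s" if "0 \<le> p" "p < m" "p \<le> r" "r \<le> s" "s \<le> p + m" for p r s
  proof -
    consider "s \<le> m" | "r \<le> m" "m < s" | "m < r" by linarith
    then show ?thesis
    proof cases
      case 1
      then show ?thesis using D0 that by simp
    next
      case 2
      then show ?thesis using D1[of "s - m" p r] that by simp
    next
      case 3
      \<comment> \<open>The point is the turn of a point in the first block.\<close>
      then show ?thesis using D0[of "r - m" "s - m" p] turn[of "r - m" "s - m" p] that by simp
    qed
  qed
  have E1: "E p r s" if "0 \<le> p" "p < 2 * m" "p \<le> r" "r \<le> s" "s \<le> p + m" for p r s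
  proof -
    consider "p < m" | "m \<le> p" "r < 2 * m" | "2 * m \<le> r" by linarith
    then show ?thesis
    proof cases
      case 1
      then show ?thesis using E0 that by simp
    next
      case 2
      then show ?thesis using E0[of "r - m" "s - m" p] turn[of "r - m" "s - m" p] that by simp
    next
      case 3
      \<comment> \<open>Undoing two turns leads from \<open>(p, r, s)\<close> to
        \<open>(s - 2 * m, p - m, r - m)\<close>.\<close>
      then show ?thesis
        using E0[of "s - 2 * m" "p - m" "r - m"] turn[of "s - 2 * m" "p - m" "r - m"]
          turn[of "r - m" "s - m" p] that by (simp add: algebra_simps)
    qed
  qed
  have shift: "E (p + 2 * m) (r + 2 * m) (s + 2 * m) \<longleftrightarrow> E p r s" if "p \<le> r" "r \<le> s" "s \<le> p + m" for p r s
    using turn[of p r s] turn[of s "p + m" "r + m"] turn[of "r + m" "s + m" "p + 2 * m"] that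
    by (simp add: algebra_simps)
  have "E (p + int k * (2 * m)) (r + int k * (2 * m)) (s + int k * (2 * m)) \<longleftrightarrow> E p r s"
    if "p \<le> r" "r \<le> s" "s \<le> p + m" for p r s k
  proof (induction k)
    case (Suc k)
    then show ?case
      using shift[of "p + int k * (2 * m)" "r + int k * (2 * m)" "s + int k * (2 * m)"] that
      by (simp add: algebra_simps)
  qed simp
  note shifts = this
  have "E p r s" if prs: "p \<le> r" "r \<le> s" "s \<le> p + m" for p r s
  proof -
    define k where "k = p div (2 * m)"
    have k: "0 \<le> p - k * (2 * m)" "p - k * (2 * m) < 2 * m"
      using m_pos by (simp_all add: k_def minus_div_mult_eq_mod)
    have red: "E (p - k * (2 * m)) (r - k * (2 * m)) (s - k * (2 * m))"
      using k prs by (intro E1) auto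
    show ?thesis
    proof (cases "0 \<le> k")
      case True
      then show ?thesis
        using shifts[of "p - k * (2 * m)" "r - k * (2 * m)" "s - k * (2 * m)" "nat k"] red prs by simp
    next
      case False
      then show ?thesis using shifts[OF prs, of "nat (- k)"] red by (simp add: algebra_simps)
    qed
  qed
  then show thesis using that[of A] skew unfolding E_def T_def by blast
qed

end

subsection \<open>Sweeping the initial slice\<close>

text \<open>Sorting the three indices reduces this to \<open>spin_relation\<close>. Of the
  coefficients only the fact that they are signs is recorded, which is enough for membership in a
  ring.\<close>

lemma spin_four_term:
  fixes A :: "int \<Rightarrow> int \<Rightarrow> 'a::idom"
  assumes skew: "\<And>a b. A b a = - A a b" and two: "(2 :: 'a) \<noteq> 0"
    and X: "finite X" "\<And>a. a \<in> X \<Longrightarrow> 0 \<le> a"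
    and xyz: "0 \<le> x" "0 \<le> y" "0 \<le> z" "x \<noteq> y" "y \<noteq> z" "x \<noteq> z"
  obtains e f g where "{e, f, g} \<subseteq> {1, - 1}"
    and "spin A (X \<triangle> {x}) * spin A (X \<triangle> {y, z}) =
      e * (spin A X * spin A (X \<triangle> {x, y, z})) + f * (spin A (X \<triangle> {y}) * spin A (X \<triangle> {x, z}))
      + g * (spin A (X \<triangle> {z}) * spin A (X \<triangle> {x, y}))"
proof -
  have rel: "spin A X * spin A (X \<triangle> {x, y, z}) =
    spin A (X \<triangle> {x}) * spin A (X \<triangle> {y, z}) - spin A (X \<triangle> {y}) * spin A (X \<triangle> {x, z})
      + spin A (X \<triangle> {z}) * spin A (X \<triangle> {x, y})" if "0 \<le> x" "x < y" "y < z" for x y z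
    using that by (intro spin_relation[of A, OF skew two X])
  have perm: "{x, z, y} = {x, y, z}" "{y, x, z} = {x, y, z}" "{y, z, x} = {x, y, z}" "{z, x, y} = {x, y, z}"
    "{z, y, x} = {x, y, z}" "{y, x} = {x, y}" "{z, x} = {x, z}" "{z, y} = {y, z}" by auto
  consider "x < y" "y < z" | "x < z" "z < y" | "y < x" "x < z" | "y < z" "z < x" | "z < x" "x < y" | "z < y" "y < x"
    using xyz by linarith
  then show thesis
  proof cases
    case 1
    then show thesis using rel[of x y z] xyz by (intro that[of 1 1 "- 1"]) (simp_all add: perm)
  next
    case 2
    then show thesis using rel[of x z y] xyz by (intro that[of 1 "- 1" 1]) (simp_all add: perm)
  next
    case 3
    then show thesis using rel[of y x z] xyz by (intro that[of "- 1" 1 1]) (simp_all add: perm)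
  next
    case 4
    then show thesis using rel[of y z x] xyz by (intro that[of 1 "- 1" 1]) (simp_all add: perm)
  next
    case 5
    then show thesis using rel[of z x y] xyz by (intro that[of "- 1" 1 1]) (simp_all add: perm)
  next
    case 6
    then show thesis using rel[of z y x] xyz by (intro that[of 1 1 "- 1"]) (simp_all add: perm)
  qed
qed

definition unit_in :: "'a::field set \<Rightarrow> 'a \<Rightarrow> bool" where
  "unit_in R a \<longleftrightarrow> a \<noteq> 0 \<and> a \<in> R \<and> inverse a \<in> R"

lemma unit_in_closed: "unit_in R a \<Longrightarrow> a \<in> R"
  by (simp add: unit_in_def)

text \<open>\<open>X\<close> with none, one or both of \<open>y\<close> and \<open>z\<close> toggled
  gives the corners of a rhombus. Each product of the four-term relation pairs the unit at one
  corner with the \<open>x\<close>-toggled value at the opposite corner. So the relation is linear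
  in the toggled values, and dividing by the unit opposite to \<open>X\<close> isolates the one at
  \<open>X\<close>.\<close>

lemma spin_rhombus_closed:
  fixes A :: "int \<Rightarrow> int \<Rightarrow> 'a::field"
  assumes skew: "\<And>a b. A b a = - A a b" and two: "(2 :: 'a) \<noteq> 0" and R: "subring_set R"
    and X: "finite X" "\<And>a. a \<in> X \<Longrightarrow> 0 \<le> a"
    and xyz: "0 \<le> x" "0 \<le> y" "0 \<le> z" "x \<noteq> y" "y \<noteq> z" "x \<noteq> z"
    and units: "unit_in R (spin A X)" "unit_in R (spin A (X \<triangle> {y}))" "unit_in R (spin A (X \<triangle> {z}))"
      "unit_in R (spin A (X \<triangle> {y} \<triangle> {z}))"
    and mem: "spin A (X \<triangle> {y} \<triangle> {x}) \<in> R" "spin A (X \<triangle> {z} \<triangle> {x}) \<in> R"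
      "spin A (X \<triangle> {y} \<triangle> {z} \<triangle> {x}) \<in> R"
  shows "spin A (X \<triangle> {x}) \<in> R"
proof -
  interpret subring_set R by (rule R)
  obtain e f g where efg: "{e, f, g} \<subseteq> {1, - 1}"
    and rel: "spin A (X \<triangle> {x}) * spin A (X \<triangle> {y, z}) =
      e * (spin A X * spin A (X \<triangle> {x, y, z})) + f * (spin A (X \<triangle> {y}) * spin A (X \<triangle> {x, z}))
      + g * (spin A (X \<triangle> {z}) * spin A (X \<triangle> {x, y}))"
    using spin_four_term[of A, OF skew two X xyz] by blast
  have sets: "X \<triangle> {y} \<triangle> {z} = X \<triangle> {y, z}" "X \<triangle> {y} \<triangle> {x} = X \<triangle> {x, y}"
    "X \<triangle> {z} \<triangle> {x} = X \<triangle> {x, z}" "X \<triangle> {y} \<triangle> {z} \<triangle> {x} = X \<triangle> {x, y, z}"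
    using xyz by auto
  have "e \<in> R" "f \<in> R" "g \<in> R"
    using efg one_closed uminus_closed[OF one_closed] by auto
  then have prod: "spin A (X \<triangle> {x}) * spin A (X \<triangle> {y, z}) \<in> R"
    unfolding rel using units(1-3) mem unfolding sets(4) unfolding sets(2,3)
    by (intro add_closed mult_closed) (auto dest: unit_in_closed)
  have u: "unit_in R (spin A (X \<triangle> {y, z}))" using units(4) unfolding sets .
  have "spin A (X \<triangle> {x}) = spin A (X \<triangle> {x}) * spin A (X \<triangle> {y, z}) * inverse (spin A (X \<triangle> {y, z}))"
    using u by (simp add: unit_in_def)
  also have "\<dots> \<in> R" using u by (intro mult_closed[OF prod]) (simp add: unit_in_def)
  finally show ?thesis .
qed

lemma symdiff_cancel: "X \<triangle> Y \<triangle> Y = X"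
  by auto

lemma mod_neq_mod: "a < b \<Longrightarrow> b < a + m \<Longrightarrow> a mod m \<noteq> b mod (m :: int)"
  using zdvd_not_zless[of "b - a" m] by (auto simp: mod_eq_dvd_iff[of b m a] eq_commute[of "a mod m"])

text \<open>Induction on \<open>s - r\<close>; for equal \<open>s - r\<close> the middle level \<open>t + 1\<close> comes first, because its points
  serve as corners for those of levels \<open>t\<close> and \<open>t + 2\<close>.  Where a corner falls outside the prism, two
  points of the boundary have the same set.\<close>

lemma spin_wedge_closed:
  fixes A :: "int \<Rightarrow> int \<Rightarrow> 'a::field" and m :: int
  defines "T \<equiv> \<lambda>C p r s. crossings m p \<triangle> crossings m r \<triangle> crossings m s \<triangle> C"
  assumes skew: "\<And>a b. A b a = - A a b" and two: "(2 :: 'a) \<noteq> 0" and R: "subring_set R" and m: "0 < m"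
    and C: "finite C" "\<And>x. x \<in> C \<Longrightarrow> 0 \<le> x"
    and units: "\<And>p r s. p \<le> r \<Longrightarrow> r \<le> s \<Longrightarrow> s \<le> p + m \<Longrightarrow> p + r + s \<in> {t, t + 1, t + 2} \<Longrightarrow>
      unit_in R (spin A (T C p r s))"
    and prs: "p \<le> r" "r \<le> s" "s \<le> p + m" "p + r + s \<in> {t, t + 1, t + 2}" and x: "r \<le> x" "x < s"
  shows "spin A (T C p r s \<triangle> {x mod m}) \<in> R"
  using prs x
proof (induction "nat (2 * (s - r) + (if p + r + s = t + 1 then 0 else 1))" arbitrary: p r s rule: less_induct)
  case less
  have fin: "finite (T C p r s)" "\<And>a. a \<in> T C p r s \<Longrightarrow> 0 \<le> a" for p r s
    using C by (auto simp: T_def dest: crossings_nonneg)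
  have nonneg: "0 \<le> a mod m" for a using m by simp
  have up: "T C (p + 1) r s = T C p r s \<triangle> {p mod m}" "T C p (r + 1) s = T C p r s \<triangle> {r mod m}"
    "T C p r (s + 1) = T C p r s \<triangle> {s mod m}" for p r s
    unfolding T_def crossings_Suc[OF m] by auto
  have down: "T C (p - 1) r s = T C p r s \<triangle> {(p - 1) mod m}" "T C p r (s - 1) = T C p r s \<triangle> {(s - 1) mod m}" for p r s
    using up(1)[of "p - 1" r s] up(3)[of p r "s - 1"] by auto
  have IH: "spin A (T C p' r' s' \<triangle> {x mod m}) \<in> R"
    if "2 * (s' - r') + (if p' + r' + s' = t + 1 then 0 else 1) < 2 * (s - r) + (if p + r + s = t + 1 then 0 else 1)"
      "p' \<le> r'" "r' \<le> s'" "s' \<le> p' + m" "p' + r' + s' \<in> {t, t + 1, t + 2}" "r' \<le> x" "x < s'" for p' r' s'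
    using that by (intro less.hyps) (auto split: if_splits)
  have unitE: "unit_in R (spin A X)" if "X = T C p' r' s'" "p' \<le> r'" "r' \<le> s'" "s' \<le> p' + m" "p' + r' + s' \<in> {t, t + 1, t + 2}"
    for X p' r' s'
    using units that by simp
  have level: "p + r + s = t \<or> p + r + s = t + 1 \<or> p + r + s = t + 2" using less.prems by auto
  \<comment> \<open>If \<open>x\<close> is an end of \<open>{r..<s}\<close> and the adjacent level
    belongs to the slice, toggling it just moves a walker. Otherwise the rhombus must stay within
    the three levels: \<open>r\<close> forward and \<open>s\<close> back on the middle level,
    \<open>p\<close> and \<open>r\<close> forward on the lowest, \<open>p\<close> and
    \<open>s\<close> back on the highest.\<close>
  consider "x = s - 1" "p + r + s \<noteq> t" | "x = r" "p + r + s \<noteq> t + 2"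
    | "p + r + s = t + 1" "r < x" "x < s - 1"
    | "p + r + s = t" "p = r" "r < x" | "p + r + s = t" "p < r" "r < x"
    | "p + r + s = t + 2" "s = p + m" "x < s - 1" | "p + r + s = t + 2" "s < p + m" "x < s - 1"
    using level less.prems by (smt (verit))
  then show ?case
  proof cases
    case 1
    then show ?thesis
      using less.prems level by (intro unit_in_closed[OF unitE[of _ p r "s - 1"]]) (auto simp: down)
  next
    case 2
    then show ?thesis
      using less.prems level by (intro unit_in_closed[OF unitE[of _ p "r + 1" s]]) (auto simp: up)
  next
    case 3
    let ?y = "r mod m" and ?z = "(s - 1) mod m"
    have ne: "x mod m \<noteq> ?y" "?y \<noteq> ?z" "x mod m \<noteq> ?z"
      using mod_neq_mod[of r x m] mod_neq_mod[of r "s - 1" m] mod_neq_mod[of x "s - 1" m] 3 less.prems by auto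
    have Y: "T C p r s \<triangle> {?y} = T C p (r + 1) s" and Z: "T C p r s \<triangle> {?z} = T C p r (s - 1)"
      and YZ: "T C p r s \<triangle> {?y} \<triangle> {?z} = T C p (r + 1) (s - 1)" by (simp_all only: up down)
    show ?thesis
    proof (rule spin_rhombus_closed[of A, OF skew two R fin nonneg nonneg nonneg ne])
      show "unit_in R (spin A (T C p r s))" "unit_in R (spin A (T C p r s \<triangle> {?y}))"
        "unit_in R (spin A (T C p r s \<triangle> {?z}))" "unit_in R (spin A (T C p r s \<triangle> {?y} \<triangle> {?z}))"
        unfolding YZ unfolding Y Z by (rule units; use 3 less.prems in simp)+
      show "spin A (T C p r s \<triangle> {?y} \<triangle> {x mod m}) \<in> R" "spin A (T C p r s \<triangle> {?z} \<triangle> {x mod m}) \<in> R"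
        "spin A (T C p r s \<triangle> {?y} \<triangle> {?z} \<triangle> {x mod m}) \<in> R"
        unfolding YZ unfolding Y Z by (rule IH; use 3 less.prems in simp)+
    qed
  next
    case 4
    have "T C (p + 1) (r + 1) s = T C p r s" unfolding up using 4 by auto
    moreover have "spin A (T C (p + 1) (r + 1) s \<triangle> {x mod m}) \<in> R" by (rule IH) (use 4 less.prems in simp_all)
    ultimately show ?thesis by simp
  next
    case 5
    let ?y = "p mod m" and ?z = "r mod m"
    have ne: "x mod m \<noteq> ?y" "?y \<noteq> ?z" "x mod m \<noteq> ?z"
      using mod_neq_mod[of p x m] mod_neq_mod[of p r m] mod_neq_mod[of r x m] 5 less.prems by auto
    have Y: "T C p r s \<triangle> {?y} = T C (p + 1) r s" and Z: "T C p r s \<triangle> {?z} = T C p (r + 1) s"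
      and YZ: "T C p r s \<triangle> {?y} \<triangle> {?z} = T C (p + 1) (r + 1) s" by (simp_all only: up)
    show ?thesis
    proof (rule spin_rhombus_closed[of A, OF skew two R fin nonneg nonneg nonneg ne])
      show "unit_in R (spin A (T C p r s))" "unit_in R (spin A (T C p r s \<triangle> {?y}))"
        "unit_in R (spin A (T C p r s \<triangle> {?z}))" "unit_in R (spin A (T C p r s \<triangle> {?y} \<triangle> {?z}))"
        unfolding YZ unfolding Y Z by (rule units; use 5 less.prems in simp)+
      show "spin A (T C p r s \<triangle> {?y} \<triangle> {x mod m}) \<in> R" "spin A (T C p r s \<triangle> {?z} \<triangle> {x mod m}) \<in> R"
        "spin A (T C p r s \<triangle> {?y} \<triangle> {?z} \<triangle> {x mod m}) \<in> R"
        unfolding YZ unfolding Y Z by (rule IH; use 5 less.prems in simp)+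
    qed
  next
    case 6
    \<comment> \<open>As \<open>s = p + m\<close>, the backward steps of the first and last walker
      cross the same residue, and the toggles cancel.\<close>
    have "T C (p - 1) r (s - 1) = T C p r s"
      unfolding down using 6 mod_add_self2[of "p - 1" m] by (auto simp: algebra_simps)
    moreover have "spin A (T C (p - 1) r (s - 1) \<triangle> {x mod m}) \<in> R" by (rule IH) (use 6 less.prems in simp_all)
    ultimately show ?thesis by simp
  next
    case 7
    let ?y = "(p - 1) mod m" and ?z = "(s - 1) mod m"
    have ne: "x mod m \<noteq> ?y" "?y \<noteq> ?z" "x mod m \<noteq> ?z"
      using mod_neq_mod[of "p - 1" x m] mod_neq_mod[of "p - 1" "s - 1" m] mod_neq_mod[of x "s - 1" m] 7 less.prems by auto
    have Y: "T C p r s \<triangle> {?y} = T C (p - 1) r s" and Z: "T C p r s \<triangle> {?z} = T C p r (s - 1)"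
      and YZ: "T C p r s \<triangle> {?y} \<triangle> {?z} = T C (p - 1) r (s - 1)" by (simp_all only: down)
    show ?thesis
    proof (rule spin_rhombus_closed[of A, OF skew two R fin nonneg nonneg nonneg ne])
      show "unit_in R (spin A (T C p r s))" "unit_in R (spin A (T C p r s \<triangle> {?y}))"
        "unit_in R (spin A (T C p r s \<triangle> {?z}))" "unit_in R (spin A (T C p r s \<triangle> {?y} \<triangle> {?z}))"
        unfolding YZ unfolding Y Z by (rule units; use 7 less.prems in simp)+
      show "spin A (T C p r s \<triangle> {?y} \<triangle> {x mod m}) \<in> R" "spin A (T C p r s \<triangle> {?z} \<triangle> {x mod m}) \<in> R"
        "spin A (T C p r s \<triangle> {?y} \<triangle> {?z} \<triangle> {x mod m}) \<in> R"
        unfolding YZ unfolding Y Z by (rule IH; use 7 less.prems in simp)+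
    qed
  qed
qed

text \<open>The residue \<open>x\<close> has one representative in \<open>{p..<p + m}\<close>.
  Whichever gap contains it, a cyclic relabelling makes this the gap between the second and third
  walker, as \<open>spin_wedge_closed\<close> requires. Relabelling shifts one walker by
  \<open>m\<close> and so toggles every residue, which the constant set there absorbs.\<close>

lemma spin_strand_closed:
  fixes A :: "int \<Rightarrow> int \<Rightarrow> 'a::field" and m :: int
  defines "T \<equiv> \<lambda>p r s. crossings m p \<triangle> crossings m r \<triangle> crossings m s"
  assumes skew: "\<And>a b. A b a = - A a b" and two: "(2 :: 'a) \<noteq> 0" and R: "subring_set R" and m: "0 < m"
    and units: "\<And>p r s. p \<le> r \<Longrightarrow> r \<le> s \<Longrightarrow> s \<le> p + m \<Longrightarrow> p + r + s \<in> {t, t + 1, t + 2} \<Longrightarrow>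
      unit_in R (spin A (T p r s))"
    and prs: "p \<le> r" "r \<le> s" "s \<le> p + m" "p + r + s \<in> {t, t + 1, t + 2}" and x: "0 \<le> x" "x < m"
  shows "spin A (T p r s \<triangle> {x}) \<in> R"
proof -
  define y where "y = p + (x - p) mod m"
  have y: "p \<le> y" "y < p + m" "y mod m = x"
    using m x by (simp_all add: y_def mod_add_right_eq)
  have turn1: "T r s (p + m) \<triangle> {0..<m} = T p r s" for p r s
    unfolding T_def crossings_add[OF m] by auto
  have turn2: "T (s - m) p r \<triangle> {0..<m} = T p r s" for p r s
    using arg_cong[OF turn1[where p = "s - m" and r = p and s = r], of "\<lambda>X. X \<triangle> {0..<m}"] by (simp only: symdiff_cancel diff_add_cancel)
  consider "y < r" | "r \<le> y" "y < s" | "s \<le> y" by linarith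
  then show ?thesis
  proof cases
    case 1
    have "spin A (T (s - m) p r \<triangle> {0..<m} \<triangle> {y mod m}) \<in> R"
      unfolding T_def
    proof (rule spin_wedge_closed[of A, OF skew two R m, where t = "t - m"])
      fix p r s :: int
      assume "p \<le> r" "r \<le> s" "s \<le> p + m" "p + r + s \<in> {t - m, t - m + 1, t - m + 2}"
      then have "unit_in R (spin A (T r s (p + m)))" by (intro units) auto
      moreover have "T r s (p + m) = T p r s \<triangle> {0..<m}" by (simp only: turn1[where p = p and r = r and s = s, symmetric] symdiff_cancel)
      ultimately show "unit_in R (spin A (crossings m p \<triangle> crossings m r \<triangle> crossings m s \<triangle> {0..<m}))"
        by (simp only: T_def)
    qed (use prs y 1 in auto)
    then show ?thesis by (simp only: turn2 y)
  next
    case 2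
    have "spin A (T p r s \<triangle> {} \<triangle> {y mod m}) \<in> R"
      unfolding T_def
      by (rule spin_wedge_closed[of A, OF skew two R m, where t = t]) (use prs y 2 units in \<open>auto simp: T_def\<close>)
    then show ?thesis using y by simp
  next
    case 3
    have "spin A (T r s (p + m) \<triangle> {0..<m} \<triangle> {y mod m}) \<in> R"
      unfolding T_def
    proof (rule spin_wedge_closed[of A, OF skew two R m, where t = "t + m"])
      fix p r s :: int
      assume "p \<le> r" "r \<le> s" "s \<le> p + m" "p + r + s \<in> {t + m, t + m + 1, t + m + 2}"
      then have "unit_in R (spin A (T (s - m) p r))" by (intro units) auto
      moreover have "T (s - m) p r = T p r s \<triangle> {0..<m}" by (simp only: turn2[of s p r, symmetric] symdiff_cancel)
      ultimately show "unit_in R (spin A (crossings m p \<triangle> crossings m r \<triangle> crossings m s \<triangle> {0..<m}))"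
        by (simp only: T_def)
    qed (use prs y 3 in auto)
    then show ?thesis by (simp only: turn1 y)
  qed
qed

text \<open>In the expansion of the Pfaffian for \<open>insert x {0..<y + 1}\<close> along
  \<open>x\<close>, the cofactor of \<open>A x y\<close> is the Pfaffian for \<open>{0..<y}\<close>,
  which is a sign. The other terms involve entries of \<open>x\<close> with partners below
  \<open>y\<close> and entries among indices below \<open>x\<close>. Hence the induction on
  \<open>x\<close> and, inside it, on \<open>y\<close>.\<close>

lemma skew_entries_closed:
  fixes A :: "int \<Rightarrow> int \<Rightarrow> 'a::comm_ring_1"
  assumes skew: "\<And>a b. A b a = - A a b" and R: "subring_set R"
    and initial: "\<And>y. 0 \<le> y \<Longrightarrow> y < m \<Longrightarrow> spin A {0..<y} \<in> {1, - 1}"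
    and mem: "\<And>x y. 0 \<le> y \<Longrightarrow> y \<le> x \<Longrightarrow> x < m \<Longrightarrow> spin A (insert x {0..<y}) \<in> R"
    and "- 1 \<le> y" "y < x" "x < m"
  shows "A y x \<in> R"
proof -
  interpret subring_set R by (rule R)
  have "\<forall>y. - 1 \<le> y \<and> y < x \<longrightarrow> A y x \<in> R" if "x < m"
    using that
  proof (induction "nat x" arbitrary: x rule: less_induct)
    case less
    have IHx: "A u v \<in> R" if "- 1 \<le> u" "u < v" "v < x" for u v
      using less.hyps[of v] less.prems that by (cases "0 \<le> v") auto
    have "A y x \<in> R" if "- 1 \<le> y" "y < x" for y
      using that
    proof (induction "nat (y + 1)" arbitrary: y rule: less_induct)
      case (less y)
      note IHy = less.hyps
      show ?case
      proof (cases "y = - 1")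
        case True
        then show ?thesis using mem[of 0 x] less.prems \<open>x < m\<close> by (simp add: spin_singleton)
      next
        case False
        then have y: "0 \<le> y" "y < x" using less.prems by auto
        define X where "X = insert x {0..<y + 1}"
        define E where "E = (if even (card X) then X else insert (- 1) X)"
        define Y where "Y = E - {x} - {y}"
        have E: "finite E" "x \<in> E" "y \<in> E - {x}" "E \<subseteq> insert x {- 1..y}"
          using y by (auto simp: E_def X_def)
        have bounds: "- 1 \<le> w" "w < y" if "w \<in> Y" for w
          using that E(4) by (auto simp: Y_def)
        have "pfaffian A E \<in> R"
        proof -
          have "pfaffian A E = spin A X" by (simp add: E_def spin_def)
          then show ?thesis using mem[of "y + 1" x] y \<open>x < m\<close> by (simp add: X_def)
        qed
        then have row: "pfaffian_row A x (E - {x}) \<in> R"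
          using pfaffian_expand[of A, OF skew E(1,2)] by (simp add: mult_closed position_sign_closed)
        have rest: "position_sign w (E - {x}) * A x w * pfaffian A (E - {x} - {w}) \<in> R" if w: "w \<in> Y" for w
        proof -
          have "A w x \<in> R" using bounds[OF w] y by (intro IHy) auto
          then have "A x w \<in> R" by (metis skew uminus_closed)
          moreover have "pfaffian A (E - {x} - {w}) \<in> R"
            using E(4) y by (intro pfaffian_closed IHx) auto
          ultimately show ?thesis by (intro mult_closed position_sign_closed)
        qed
        \<comment> \<open>Removing two indices preserves parity, so the border index is present on
          both sides or on neither.\<close>
        have "pfaffian A Y = spin A {0..<y}"
        proof -
          have "nat (y + 1) = Suc (nat y)" using y by simp
          then have "even (card X) \<longleftrightarrow> even (card {0..<y})" using y by (simp add: X_def)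
          moreover have "Y = (if even (card X) then {0..<y} else insert (- 1) {0..<y})"
            using y by (auto simp: Y_def E_def X_def)
          ultimately show ?thesis by (simp add: spin_def)
        qed
        then have unit: "pfaffian A Y \<in> {1, - 1}" using initial[of y] y \<open>x < m\<close> by simp
        have "pfaffian_row A x (E - {x}) =
            position_sign y (E - {x}) * A x y * pfaffian A Y +
            (\<Sum>w\<in>Y. position_sign w (E - {x}) * A x w * pfaffian A (E - {x} - {w}))"
          unfolding pfaffian_row_def Y_def using E by (subst sum.remove[of _ y]) auto
        then have "position_sign y (E - {x}) * A x y * pfaffian A Y =
            pfaffian_row A x (E - {x}) - (\<Sum>w\<in>Y. position_sign w (E - {x}) * A x w * pfaffian A (E - {x} - {w}))"
          by simp
        also have "\<dots> \<in> R" using row rest by (intro diff_closed sum_closed)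
        finally have "position_sign y (E - {x}) * (position_sign y (E - {x}) * A x y * pfaffian A Y) \<in> R"
          by (rule mult_closed[OF position_sign_closed])
        then have "A x y * pfaffian A Y \<in> R" by (simp add: mult.assoc)
        then have "A x y \<in> R" using unit uminus_closed by fastforce
        then show ?thesis by (metis skew uminus_closed)
      qed
    qed
    then show ?case by blast
  qed
  then show ?thesis using assms by blast
qed

section \<open>Membership of every prism value in the ring\<close>

context prism
begin

lemma F_closed:
  assumes R: "subring_set R"
    and units: "\<And>p r s. p \<le> r \<Longrightarrow> r \<le> s \<Longrightarrow> s \<le> p + m \<Longrightarrow>
      p + r + s \<in> {2 * m, 2 * m + 1, 2 * m + 2} \<Longrightarrow> unit_in R (F p r s)"
    and "p \<le> r" "r \<le> s" "s \<le> p + m"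
  shows "F p r s \<in> R"
proof -
  interpret subring_set R by (rule R)
  define T where "T = (\<lambda>p r s. crossings m p \<triangle> crossings m r \<triangle> crossings m s)"
  obtain A where skew: "\<And>a b. A b a = - A a b"
    and A: "\<And>p r s. p \<le> r \<Longrightarrow> r \<le> s \<Longrightarrow> s \<le> p + m \<Longrightarrow> F p r s \<in> {spin A (T p r s), - spin A (T p r s)}"
    using spin_parametrization_up_to_sign unfolding T_def by metis
  have unit: "unit_in R (spin A (T p r s))"
    if "p \<le> r" "r \<le> s" "s \<le> p + m" "p + r + s \<in> {2 * m, 2 * m + 1, 2 * m + 2}" for p r s
  proof -
    have "spin A (T p r s) = F p r s \<or> spin A (T p r s) = - F p r s" using A[OF that(1-3)] by auto
    moreover have "unit_in R (- F p r s)"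
      using units[OF that] uminus_closed unfolding unit_in_def by (simp add: inverse_minus_eq)
    ultimately show ?thesis using units[OF that] by metis
  qed
  have strand: "spin A (T p r s \<triangle> {x}) \<in> R"
    if "p \<le> r" "r \<le> s" "s \<le> p + m" "p + r + s \<in> {2 * m, 2 * m + 1, 2 * m + 2}" "0 \<le> x" "x < m" for p r s x
    unfolding T_def
    by (rule spin_strand_closed[of A, OF skew two_nonzero R m_pos unit[unfolded T_def] that])
  have entries: "A y x \<in> R" if "- 1 \<le> y" "y < x" "x < m" for x y
    using _ _ that
  proof (rule skew_entries_closed[of A, OF skew R])
    show "spin A {0..<y} \<in> {1, - 1}" if "0 \<le> y" "y < m" for y
    proof -
      have "T 0 0 y = {0..<y}" using that m_pos by (auto simp: T_def crossings_initial)
      then have "1 = spin A {0..<y} \<or> 1 = - spin A {0..<y}"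
        using A[of 0 0 y] F_left[of 0 y] that by simp
      then show ?thesis by (metis insertCI minus_minus)
    qed
    show "spin A (insert x {0..<y}) \<in> R" if "0 \<le> y" "y \<le> x" "x < m" for x y
    proof -
      \<comment> \<open>Two walkers at \<open>a\<close> cancel in the crossed set and leave
        \<open>{0..<y}\<close>; this \<open>a\<close> makes the coordinate sum \<open>2 * m\<close>
        or \<open>2 * m + 1\<close>, according to the parity of \<open>y\<close>.\<close>
      define a where "a = m - y div 2"
      have lev: "y + 2 * a = 2 * m \<or> y + 2 * a = 2 * m + 1" "a \<le> m"
        using that unfolding a_def by presburger+
      have T: "T y a a = {0..<y}" "T a a y = {0..<y}"
        using that m_pos by (auto simp: T_def crossings_initial)
      have "{0..<y} \<triangle> {x} = insert x {0..<y}" using that by auto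
      moreover have "spin A ({0..<y} \<triangle> {x}) \<in> R"
      proof (cases "y \<le> a")
        case True
        have "spin A (T y a a \<triangle> {x}) \<in> R"
          using that m_pos True lev by (intro strand) auto
        then show ?thesis by (simp only: T)
      next
        case False
        have "spin A (T a a y \<triangle> {x}) \<in> R"
          using that m_pos False lev by (intro strand) auto
        then show ?thesis by (simp only: T)
      qed
      ultimately show ?thesis by simp
    qed
  qed
  have sub: "T p r s \<subseteq> {0..<m}" by (auto simp: T_def crossings_def)
  have "pfaffian A X \<in> R" if "X \<subseteq> insert (- 1) {0..<m}" for X
  proof (rule pfaffian_closed)
    fix u v assume "u \<in> X" "v \<in> X" "u < v"
    with that have "- 1 \<le> u" "v < m" using m_pos by force+
    then show "A u v \<in> R" using \<open>u < v\<close> by (intro entries)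
  qed
  then have "spin A (T p r s) \<in> R" using sub unfolding spin_def by (simp add: subset_insertI2)
  then show ?thesis using A[OF assms(3-5)] uminus_closed by auto
qed

end

subsection \<open>Laurent polynomials and the triangle\<close>

definition laurent_monomial :: "(vertex \<Rightarrow>\<^sub>0 int) \<Rightarrow> ratfun" where
  "laurent_monomial a = (\<Prod>v \<in> Poly_Mapping.keys a. indet v powi Poly_Mapping.lookup a v)"

definition laurent_eval :: "((vertex \<Rightarrow>\<^sub>0 int) \<Rightarrow>\<^sub>0 int) \<Rightarrow> ratfun" where
  "laurent_eval c = (\<Sum>a \<in> Poly_Mapping.keys c. of_int (Poly_Mapping.lookup c a) * laurent_monomial a)"

lemma laurent_polynomial_in_iff:
  "laurent_polynomial_in S g \<longleftrightarrow>
     (\<exists>c. (\<forall>a \<in> Poly_Mapping.keys c. Poly_Mapping.keys a \<subseteq> S) \<and> g = laurent_eval c)"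
  by (simp add: laurent_polynomial_in_def laurent_eval_def laurent_monomial_def)

text \<open>Additional factors have exponent 0. A common index set allows monomials with different
  supports to be multiplied factor by factor.\<close>

lemma laurent_monomial_superset:
  assumes "finite S" "Poly_Mapping.keys a \<subseteq> S"
  shows "laurent_monomial a = (\<Prod>v \<in> S. indet v powi Poly_Mapping.lookup a v)"
  unfolding laurent_monomial_def using assms
  by (intro prod.mono_neutral_left) (auto simp: in_keys_iff)

lemma laurent_monomial_add: "laurent_monomial (a + b) = laurent_monomial a * laurent_monomial b"
proof -
  define S where "S = Poly_Mapping.keys a \<union> Poly_Mapping.keys b"
  have S: "finite S" "Poly_Mapping.keys a \<subseteq> S" "Poly_Mapping.keys b \<subseteq> S" "Poly_Mapping.keys (a + b) \<subseteq> S"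
    using Poly_Mapping.keys_add[of a b] by (auto simp: S_def)
  have "indet v \<noteq> 0" for v by (rule subtraction_free_nonzero[OF subtraction_free_indet])
  then show ?thesis
    unfolding S(2,3,4)[THEN laurent_monomial_superset[OF S(1)]]
    by (simp add: lookup_add power_int_add prod.distrib)
qed

lemma laurent_monomial_zero [simp]: "laurent_monomial 0 = 1"
  by (simp add: laurent_monomial_def)

lemma laurent_monomial_single: "laurent_monomial (Poly_Mapping.single v n) = indet v powi n"
  by (simp add: laurent_monomial_def)

lemma laurent_eval_superset:
  assumes "finite S" "Poly_Mapping.keys c \<subseteq> S"
  shows "laurent_eval c = (\<Sum>a \<in> S. of_int (Poly_Mapping.lookup c a) * laurent_monomial a)"
  unfolding laurent_eval_def using assms
  by (intro sum.mono_neutral_left) (auto simp: in_keys_iff)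

lemma laurent_polynomial_in_add:
  assumes "laurent_polynomial_in S g" "laurent_polynomial_in S h"
  shows "laurent_polynomial_in S (g + h)"
proof -
  obtain c d where c: "\<forall>a \<in> Poly_Mapping.keys c. Poly_Mapping.keys a \<subseteq> S" "g = laurent_eval c"
    and d: "\<forall>a \<in> Poly_Mapping.keys d. Poly_Mapping.keys a \<subseteq> S" "h = laurent_eval d"
    using assms unfolding laurent_polynomial_in_iff by blast
  define K where "K = Poly_Mapping.keys c \<union> Poly_Mapping.keys d"
  have K: "finite K" "Poly_Mapping.keys c \<subseteq> K" "Poly_Mapping.keys d \<subseteq> K" "Poly_Mapping.keys (c + d) \<subseteq> K"
    using Poly_Mapping.keys_add[of c d] by (auto simp: K_def)
  have "laurent_eval (c + d) = laurent_eval c + laurent_eval d"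
    unfolding K(2,3,4)[THEN laurent_eval_superset[OF K(1)]]
    by (simp add: lookup_add distrib_right sum.distrib)
  moreover have "\<forall>a \<in> Poly_Mapping.keys (c + d). Poly_Mapping.keys a \<subseteq> S"
    using K(4) c(1) d(1) unfolding K_def by blast
  ultimately show ?thesis unfolding laurent_polynomial_in_iff c(2) d(2) by metis
qed

lemma laurent_polynomial_in_monomial:
  assumes "Poly_Mapping.keys a \<subseteq> S"
  shows "laurent_polynomial_in S (of_int n * laurent_monomial a)"
  unfolding laurent_polynomial_in_iff
  by (intro exI[of _ "Poly_Mapping.single a n"]) (use assms in \<open>auto simp: laurent_eval_def\<close>)

lemma laurent_polynomial_in_sum:
  "(\<And>x. x \<in> X \<Longrightarrow> laurent_polynomial_in S (g x)) \<Longrightarrow> laurent_polynomial_in S (\<Sum>x\<in>X. g x)"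
proof (induction X rule: infinite_finite_induct)
  case (insert x X)
  then show ?case by (simp add: laurent_polynomial_in_add)
qed (use laurent_polynomial_in_monomial[of 0 S 0] in simp_all)

text \<open>Expanding both factors gives a finite double sum of monomials, so closure under sums
  suffices and the coefficients of the product need not be collected.\<close>

lemma laurent_polynomial_in_mult:
  assumes "laurent_polynomial_in S g" "laurent_polynomial_in S h"
  shows "laurent_polynomial_in S (g * h)"
proof -
  obtain c d where c: "\<forall>a \<in> Poly_Mapping.keys c. Poly_Mapping.keys a \<subseteq> S" "g = laurent_eval c"
    and d: "\<forall>a \<in> Poly_Mapping.keys d. Poly_Mapping.keys a \<subseteq> S" "h = laurent_eval d"
    using assms unfolding laurent_polynomial_in_iff by blast
  have "g * h = (\<Sum>a \<in> Poly_Mapping.keys c. \<Sum>b \<in> Poly_Mapping.keys d.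
      of_int (Poly_Mapping.lookup c a * Poly_Mapping.lookup d b) * laurent_monomial (a + b))"
    unfolding c(2) d(2) laurent_eval_def sum_product by (simp add: laurent_monomial_add mult_ac)
  also have "laurent_polynomial_in S \<dots>"
  proof (intro laurent_polynomial_in_sum laurent_polynomial_in_monomial)
    fix a b assume "a \<in> Poly_Mapping.keys c" "b \<in> Poly_Mapping.keys d"
    then show "Poly_Mapping.keys (a + b) \<subseteq> S" using c(1) d(1) Poly_Mapping.keys_add[of a b] by blast
  qed
  finally show ?thesis .
qed

lemma subring_set_laurent_polynomials: "subring_set {g. laurent_polynomial_in S g}"
proof
  have const: "laurent_polynomial_in S (of_int n)" for n
    using laurent_polynomial_in_monomial[of 0 S n] by simp
  show "1 \<in> {g. laurent_polynomial_in S g}" using const[of 1] by simp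
  show "- a \<in> {g. laurent_polynomial_in S g}" if "a \<in> {g. laurent_polynomial_in S g}" for a
    using laurent_polynomial_in_mult[OF const[of "- 1"], of a] that by simp
qed (simp_all add: laurent_polynomial_in_add laurent_polynomial_in_mult)

lemma unit_in_indet:
  assumes "v \<in> S"
  shows "unit_in {g. laurent_polynomial_in S g} (indet v)"
proof -
  have "laurent_polynomial_in S (indet v powi n)" for n
    using laurent_polynomial_in_monomial[of "Poly_Mapping.single v n" S 1] assms
    by (auto simp: laurent_monomial_single split: if_splits)
  from this[of 1] this[of "- 1"] show ?thesis
    by (simp add: unit_in_def power_int_minus subtraction_free_nonzero[OF subtraction_free_indet])
qed

section \<open>Coordinates linking the triangle with the prism\<close>

definition prism_vertex :: "int \<Rightarrow> int \<Rightarrow> int \<Rightarrow> int \<Rightarrow> vertex" where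
  "prism_vertex m p r s = (r - p, p + m - s, s - r)"

text \<open>Points \<open>p \<le> r \<le> s \<le> p + m\<close> correspond bijectively to pairs of a vertex of the triangle and a
  time congruent to its color.\<close>

definition on_prism :: "int \<Rightarrow> (vertex \<Rightarrow> int \<Rightarrow> 'a) \<Rightarrow> int \<Rightarrow> int \<Rightarrow> int \<Rightarrow> 'a" where
  "on_prism m f p r s = f (prism_vertex m p r s) (p + r + s - 2 * m)"

lemma color_prism_vertex: "[p + r + s - 2 * m = color (prism_vertex m p r s)] (mod 3)"
proof -
  have "p + r + s - 2 * m - (p + m - s - (s - r)) = 3 * (s - m)" by simp
  then have "[p + r + s - 2 * m = p + m - s - (s - r)] (mod 3)" by (simp only: cong_iff_dvd_diff dvd_triv_left)
  then show ?thesis by (simp add: prism_vertex_def cong_def)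
qed

lemma prism_vertex_interior: "p < r \<Longrightarrow> r < s \<Longrightarrow> s < p + m \<Longrightarrow> prism_vertex m p r s \<in> triangle_interior m"
  by (simp add: prism_vertex_def triangle_interior_def triangle_boundary_def triangle_def)

lemma prism_vertex_boundary:
  "p \<le> r \<Longrightarrow> r \<le> s \<Longrightarrow> s \<le> p + m \<Longrightarrow> p = r \<or> r = s \<or> s = p + m \<Longrightarrow> prism_vertex m p r s \<in> triangle_boundary m"
  by (auto simp: prism_vertex_def triangle_boundary_def triangle_def)

lemma prism_vertex_surj:
  assumes "v \<in> triangle m" "[t = color v] (mod 3)"
  obtains p r s where "p \<le> r" "r \<le> s" "s \<le> p + m" "v = prism_vertex m p r s" "t = p + r + s - 2 * m"
proof -
  obtain i j k where v: "v = (i, j, k)" by (cases v)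
  have ijk: "i + j + k = m" "0 \<le> i" "0 \<le> j" "0 \<le> k" using assms(1) by (auto simp: v triangle_def)
  have "[t = j - k] (mod 3)" using assms(2) by (simp add: v cong_def)
  then have "3 dvd t - (j - k)" by (simp add: cong_iff_dvd_diff)
  then obtain q where q: "t = j - k + 3 * q" by (auto simp: dvd_def algebra_simps)
  \<comment> \<open>The gaps force \<open>r = p + i\<close> and \<open>s = p + i + k\<close>. The
    time then equals \<open>3 * p - 2 * j - k\<close>, so \<open>p = q + j\<close>; the congruence
    is what makes \<open>p\<close> an integer.\<close>
  show thesis
    by (rule that[of "q + j" "q + j + i" "q + j + i + k"]) (use q ijk in \<open>auto simp: v prism_vertex_def\<close>)
qed

lemma color_eq_if_cong: "[t = color v] (mod 3) \<Longrightarrow> 0 \<le> t \<Longrightarrow> t < 3 \<Longrightarrow> t = color v"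
  by (cases v) (auto simp: cong_def)

section \<open>The cube recurrence as a function on the prism\<close>

context
  fixes m :: int and f :: "vertex \<Rightarrow> int \<Rightarrow> ratfun"
  assumes f: "cube_recurrence m f"
begin

lemma on_prism_boundary:
  "p \<le> r \<Longrightarrow> r \<le> s \<Longrightarrow> s \<le> p + m \<Longrightarrow> p = r \<or> r = s \<or> s = p + m \<Longrightarrow> on_prism m f p r s = 1"
  using f prism_vertex_boundary[of p r s m] color_prism_vertex[of p r s m]
  unfolding cube_recurrence_def on_prism_def by blast

text \<open>On these levels the time is 0, 1 or 2; being congruent to the color, it is the color
  itself.\<close>

lemma on_prism_initial:
  assumes "p < r" "r < s" "s < p + m" and "p + r + s \<in> {2 * m, 2 * m + 1, 2 * m + 2}"
  shows "on_prism m f p r s = indet (prism_vertex m p r s)"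
proof -
  have "p + r + s - 2 * m = color (prism_vertex m p r s)"
    using color_prism_vertex assms(4) by (intro color_eq_if_cong) auto
  then show ?thesis
    using f prism_vertex_interior[OF assms(1-3)] unfolding cube_recurrence_def on_prism_def by simp
qed

text \<open>A step of all three walkers fixes the vertex and adds 3 to the time. Adding
  \<open>e12\<close>, \<open>e23\<close> or \<open>e31\<close> while the time grows by 2 is a step
  of two walkers; subtracting it while the time grows by 1 is a step of the remaining one.\<close>

lemma cube_relation_on_prism:
  assumes "p < r" "r < s" "s < p + m"
  shows "cube_relation (on_prism m f) p r s"
proof -
  let ?v = "prism_vertex m p r s" and ?t = "p + r + s - 2 * m"
  have v: "?v + e12 = prism_vertex m p (r + 1) (s + 1)" "?v - e12 = prism_vertex m (p + 1) r s"
    "?v + e23 = prism_vertex m (p + 1) (r + 1) s" "?v - e23 = prism_vertex m p r (s + 1)"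
    "?v + e31 = prism_vertex m (p + 1) r (s + 1)" "?v - e31 = prism_vertex m p (r + 1) s"
    "?v = prism_vertex m (p + 1) (r + 1) (s + 1)"
    by (simp_all add: prism_vertex_def e12_def e23_def e31_def)
  have t: "?t + 2 = p + (r + 1) + (s + 1) - 2 * m" "?t + 2 = (p + 1) + (r + 1) + s - 2 * m"
    "?t + 2 = (p + 1) + r + (s + 1) - 2 * m" "?t + 1 = (p + 1) + r + s - 2 * m" "?t + 1 = p + (r + 1) + s - 2 * m"
    "?t + 1 = p + r + (s + 1) - 2 * m" "?t + 3 = (p + 1) + (r + 1) + (s + 1) - 2 * m"
    by simp_all
  have "f ?v (?t + 3) * f ?v ?t =
          f (?v + e12) (?t + 2) * f (?v - e12) (?t + 1) +
          f (?v + e23) (?t + 2) * f (?v - e23) (?t + 1) +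
          f (?v + e31) (?t + 2) * f (?v - e31) (?t + 1)"
    using f prism_vertex_interior[OF assms] color_prism_vertex[of p r s m] unfolding cube_recurrence_def by blast
  moreover have "f ?v (?t + 3) = on_prism m f (p + 1) (r + 1) (s + 1)" "f ?v ?t = on_prism m f p r s"
    "f (?v + e12) (?t + 2) = on_prism m f p (r + 1) (s + 1)" "f (?v - e12) (?t + 1) = on_prism m f (p + 1) r s"
    "f (?v + e23) (?t + 2) = on_prism m f (p + 1) (r + 1) s" "f (?v - e23) (?t + 1) = on_prism m f p r (s + 1)"
    "f (?v + e31) (?t + 2) = on_prism m f (p + 1) r (s + 1)" "f (?v - e31) (?t + 1) = on_prism m f p (r + 1) s"
    unfolding on_prism_def v(1-6) unfolding v(7)[symmetric] t[symmetric] by (simp_all only: t[symmetric])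
  ultimately show ?thesis unfolding cube_relation_def by (simp add: mult.commute add_ac)
qed

text \<open>This supplies the nonvanishing that \<open>prism\<close> demands. The induction is on
  the distance from the initial slice, solving the cube relation for its latest value after the
  slice and for its earliest value before it.\<close>

lemma subtraction_free_on_prism:
  assumes "p \<le> r" "r \<le> s" "s \<le> p + m"
  shows "subtraction_free (on_prism m f p r s)"
proof -
  have "subtraction_free (on_prism m f p r s)"
    if "p \<le> r" "r \<le> s" "s \<le> p + m" "2 * m - int n \<le> p + r + s" "p + r + s \<le> 2 * m + 2 + int n" for n p r s
    using that
  proof (induction n arbitrary: p r s)
    case 0
    then have "p + r + s \<in> {2 * m, 2 * m + 1, 2 * m + 2}" by auto
    with 0 show ?case
      using on_prism_boundary[of p r s] on_prism_initial[of p r s] subtraction_free_one subtraction_free_indet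
      by (cases "p = r \<or> r = s \<or> s = p + m") auto
  next
    case (Suc n)
    consider "2 * m - int n \<le> p + r + s" "p + r + s \<le> 2 * m + 2 + int n" | "p = r \<or> r = s \<or> s = p + m"
      | "p < r" "r < s" "s < p + m" "p + r + s = 2 * m + 3 + int n"
      | "p < r" "r < s" "s < p + m" "p + r + s = 2 * m - 1 - int n"
      using Suc.prems by fastforce
    then show ?case
    proof cases
      case 1
      then show ?thesis using Suc by simp
    next
      case 2
      then show ?thesis using Suc.prems on_prism_boundary[of p r s] subtraction_free_one by simp
    next
      case 3
      have IH: "subtraction_free (on_prism m f (p - 1) (r - 1) (s - 1))"
        "subtraction_free (on_prism m f p (r - 1) (s - 1))" "subtraction_free (on_prism m f (p - 1) r (s - 1))"
        "subtraction_free (on_prism m f (p - 1) (r - 1) s)" "subtraction_free (on_prism m f (p - 1) r s)"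
        "subtraction_free (on_prism m f p (r - 1) s)" "subtraction_free (on_prism m f p r (s - 1))"
        by (rule Suc.IH; use 3 in simp)+
      have "cube_relation (on_prism m f) (p - 1) (r - 1) (s - 1)"
        using 3 by (intro cube_relation_on_prism) simp_all
      then have "on_prism m f p r s = (on_prism m f p (r - 1) (s - 1) * on_prism m f (p - 1) r s +
          on_prism m f (p - 1) r (s - 1) * on_prism m f p (r - 1) s +
          on_prism m f (p - 1) (r - 1) s * on_prism m f p r (s - 1)) / on_prism m f (p - 1) (r - 1) (s - 1)"
        using subtraction_free_nonzero[OF IH(1)] by (simp add: cube_relation_def nonzero_eq_divide_eq)
      then show ?thesis
        using IH by (simp add: subtraction_free_add subtraction_free_mult subtraction_free_divide)
    next
      case 4
      have IH: "subtraction_free (on_prism m f (p + 1) (r + 1) (s + 1))"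
        "subtraction_free (on_prism m f p (r + 1) (s + 1))" "subtraction_free (on_prism m f (p + 1) r (s + 1))"
        "subtraction_free (on_prism m f (p + 1) (r + 1) s)" "subtraction_free (on_prism m f (p + 1) r s)"
        "subtraction_free (on_prism m f p (r + 1) s)" "subtraction_free (on_prism m f p r (s + 1))"
        by (rule Suc.IH; use 4 in simp)+
      have "cube_relation (on_prism m f) p r s"
        using 4 by (intro cube_relation_on_prism) simp_all
      then have "on_prism m f p r s = (on_prism m f (p + 1) r s * on_prism m f p (r + 1) (s + 1) +
          on_prism m f p (r + 1) s * on_prism m f (p + 1) r (s + 1) +
          on_prism m f p r (s + 1) * on_prism m f (p + 1) (r + 1) s) / on_prism m f (p + 1) (r + 1) (s + 1)"
        using subtraction_free_nonzero[OF IH(1)] by (simp add: cube_relation_def nonzero_eq_divide_eq mult.commute)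
      then show ?thesis
        using IH by (simp add: subtraction_free_add subtraction_free_mult subtraction_free_divide)
    qed
  qed
  from this[of p r s "nat \<bar>p + r + s - 2 * m\<bar>"] show ?thesis using assms by simp
qed

lemma prism_on_prism:
  assumes "0 < m"
  shows "prism m (on_prism m f)"
proof
  show "(2 :: ratfun) \<noteq> 0"
    using subtraction_free_nonzero[OF subtraction_free_add[OF subtraction_free_one subtraction_free_one]] by simp
  show "on_prism m f p r s \<noteq> 0" if "p \<le> r" "r \<le> s" "s \<le> p + m" for p r s
    by (rule subtraction_free_nonzero[OF subtraction_free_on_prism[OF that]])
qed (use assms cube_relation_on_prism in \<open>auto intro!: on_prism_boundary\<close>)

end

theorem theorem2p3:
  fixes m :: int and f :: "vertex \<Rightarrow> int \<Rightarrow> ratfun"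
  assumes "m \<ge> 3"
    and "cube_recurrence m f"
  shows "(\<forall>v \<in> triangle m. \<forall>t. [t = color v] (mod 3) \<longrightarrow>
            laurent_polynomial_in (triangle_interior m) (f v t)) \<and>
         (\<forall>v \<in> triangle m. \<forall>t. [t = color v] (mod 3) \<longrightarrow>
            f (rotation v) (t + 2 * m) = f v t) \<and>
         (\<forall>v \<in> triangle m. \<forall>t. [t = color v] (mod 3) \<longrightarrow>
            f v (t + 6 * m) = f v t)"
proof (intro conjI ballI allI impI)
  define R where "R = {g. laurent_polynomial_in (triangle_interior m) g}"
  have R: "subring_set R" unfolding R_def by (rule subring_set_laurent_polynomials)
  interpret prism m "on_prism m f" using assms by (intro prism_on_prism) simp_all
  have units: "unit_in R (on_prism m f p r s)"
    if prs: "p \<le> r" "r \<le> s" "s \<le> p + m" "p + r + s \<in> {2 * m, 2 * m + 1, 2 * m + 2}" for p r s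
  proof (cases "p = r \<or> r = s \<or> s = p + m")
    case True
    then show ?thesis
      using on_prism_boundary[OF assms(2) prs(1-3)] subring_set.one_closed[OF R] by (simp add: unit_in_def)
  next
    case False
    then have "p < r" "r < s" "s < p + m" using prs by auto
    then show ?thesis
      using on_prism_initial[OF assms(2) _ _ _ prs(4)] prism_vertex_interior unit_in_indet
      unfolding R_def by metis
  qed
  have rot: "f (rotation v) (t + 2 * m) = f v t" if v: "v \<in> triangle m" and t: "[t = color v] (mod 3)" for v t
  proof -
    obtain p r s where prs: "p \<le> r" "r \<le> s" "s \<le> p + m" "v = prism_vertex m p r s" "t = p + r + s - 2 * m"
      by (rule prism_vertex_surj[OF v t])
    \<comment> \<open>A turn of the walkers permutes the gaps cyclically and raises the coordinate
      sum by \<open>2 * m\<close>, which is the rotation together with the time shift.\<close>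
    then have "rotation v = prism_vertex m s (p + m) (r + m)" by (simp add: prism_vertex_def)
    then show ?thesis using turn[OF prs(1-3)] prs(4,5) by (simp add: on_prism_def add_ac)
  qed
  fix v t assume v: "v \<in> triangle m" and t: "[t = color v] (mod 3)"
  show "laurent_polynomial_in (triangle_interior m) (f v t)"
  proof -
    obtain p r s where prs: "p \<le> r" "r \<le> s" "s \<le> p + m" "v = prism_vertex m p r s" "t = p + r + s - 2 * m"
      by (rule prism_vertex_surj[OF v t])
    then show ?thesis using F_closed[OF R units prs(1-3)] by (simp add: R_def on_prism_def)
  qed
  show "f (rotation v) (t + 2 * m) = f v t" using v t by (rule rot)
  \<comment> \<open>Rotation changes the color by \<open>2 * m\<close> modulo 3, so
    \<open>rot\<close> can be iterated; three rotations restore the vertex.\<close>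
  have step: "rotation u \<in> triangle m" "[t + 2 * m = color (rotation u)] (mod 3)"
    if "u \<in> triangle m" "[t = color u] (mod 3)" for u t
    using that color_rotation[OF that(1)] cong_trans[OF cong_add[OF that(2) cong_refl] cong_sym]
    by (auto simp: triangle_def)
  have "f (rotation (rotation (rotation v))) (t + 2 * m + 2 * m + 2 * m) = f v t"
    using rot[OF v t] rot[OF step[OF v t]] rot[OF step[OF step[OF v t]]] by simp
  moreover have "rotation (rotation (rotation v)) = v" by (cases v) simp
  ultimately show "f v (t + 6 * m) = f v t" by (simp add: algebra_simps)
qed

end
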